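(* Let $F$ be a non-abelian free group, let $\varphi:F\to F$ be an injective endomorphism, and let $F_{\varphi}$ be the ascending HNN extension of $F$ determined by $\varphi$. If $K$ is any field, then the group ring $KF_{\varphi}$ is semiprimitive.
   Context: For a free group $F$ and an injective endomorphism $\varphi$ of $F$, the ascending HNN extension of $F$ determined by $\varphi$ is the group $F_{\varphi}=\langle F, t \mid t^{-1}ft=\varphi(f)\ (f\in F)\rangle$. A ring is semiprimitive if its Jacobson radical is zero. $F$ may have arbitrary cardinality. *)

theory Defs
  imports "HOL-Algebra.Ideal" "HOL-Algebra.Coset"
begin

section \<open>Groups given by generators and relations\<close>

text \<open>The letter \<open>(s, True)\<close> stands for the generator \<open>s\<close> and \<open>(s, False)\<close> for its formal
  inverse.  A relation \<open>(l, r)\<close> stands for the equation \<open>l = r\<close>.\<close>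

type_synonym 'g word = "('g \<times> bool) list"

definition words :: "'g set \<Rightarrow> 'g word set"
  where "words S = lists (S \<times> UNIV)"

inductive pres_cong :: "'g set \<Rightarrow> ('g word \<times> 'g word) set \<Rightarrow> 'g word \<Rightarrow> 'g word \<Rightarrow> bool"
  for S R where
  pres_refl: "w \<in> words S \<Longrightarrow> pres_cong S R w w"
| pres_sym: "pres_cong S R v w \<Longrightarrow> pres_cong S R w v"
| pres_trans: "pres_cong S R u v \<Longrightarrow> pres_cong S R v w \<Longrightarrow> pres_cong S R u w"
| pres_cancel: "u \<in> words S \<Longrightarrow> v \<in> words S \<Longrightarrow> s \<in> S \<Longrightarrow>
    pres_cong S R (u @ [(s, b), (s, \<not> b)] @ v) (u @ v)"
| pres_relation: "u \<in> words S \<Longrightarrow> v \<in> words S \<Longrightarrow> (l, r) \<in> R \<Longrightarrow> l \<in> words S \<Longrightarrow> r \<in> words S \<Longrightarrow>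
    pres_cong S R (u @ l @ v) (u @ r @ v)"

definition pres_rel :: "'g set \<Rightarrow> ('g word \<times> 'g word) set \<Rightarrow> ('g word \<times> 'g word) set"
  where "pres_rel S R = {(v, w). pres_cong S R v w}"

definition presented_group :: "'g set \<Rightarrow> ('g word \<times> 'g word) set \<Rightarrow> 'g word set monoid"
  where "presented_group S R =
    \<lparr>carrier = words S // pres_rel S R,
     monoid.mult = (\<lambda>A B. \<Union>a\<in>A. \<Union>b\<in>B. pres_rel S R `` {a @ b}),
     one = pres_rel S R `` {[]}\<rparr>"

lemma words_Nil [simp]: "[] \<in> words S"
  by (simp add: words_def)

lemma words_Cons [simp]: "x # w \<in> words S \<longleftrightarrow> fst x \<in> S \<and> w \<in> words S"
  by (cases x) (auto simp: words_def)

lemma words_append [simp]: "v @ w \<in> words S \<longleftrightarrow> v \<in> words S \<and> w \<in> words S"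
  by (auto simp: words_def)

lemma pres_cong_words: "pres_cong S R v w \<Longrightarrow> v \<in> words S \<and> w \<in> words S"
  by (induction rule: pres_cong.induct) simp_all

lemma pres_cong_context:
  "pres_cong S R v w \<Longrightarrow> x \<in> words S \<Longrightarrow> y \<in> words S \<Longrightarrow> pres_cong S R (x @ v @ y) (x @ w @ y)"
proof (induction rule: pres_cong.induct)
  case (pres_refl w)
  then show ?case by (simp add: pres_cong.pres_refl)
next
  case (pres_sym v w)
  then show ?case by (intro pres_cong.pres_sym[of S R "x @ v @ y" "x @ w @ y"])
next
  case (pres_trans u v w)
  then show ?case using pres_cong.pres_trans[of S R "x @ u @ y" "x @ v @ y" "x @ w @ y"] by blast
next
  case (pres_cancel u v s b)
  then show ?case using pres_cong.pres_cancel[of "x @ u" S "v @ y" s R b] by simp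
next
  case (pres_relation u v l r)
  then show ?case using pres_cong.pres_relation[of "x @ u" S "v @ y" l r R] by simp
qed

lemma pres_cong_append:
  assumes "pres_cong S R v v'" "pres_cong S R w w'"
  shows "pres_cong S R (v @ w) (v' @ w')"
proof (rule pres_trans)
  show "pres_cong S R (v @ w) (v' @ w)"
    using pres_cong_context[OF assms(1), of "[]" w] pres_cong_words[OF assms(2)] by simp
  show "pres_cong S R (v' @ w) (v' @ w')"
    using pres_cong_context[OF assms(2), of v' "[]"] pres_cong_words[OF assms(1)] by simp
qed

lemma equiv_pres_rel: "equiv (words S) (pres_rel S R)"
proof (rule equivI)
  show "pres_rel S R \<subseteq> words S \<times> words S"
    by (auto simp: pres_rel_def dest: pres_cong_words)
  show "refl_on (words S) (pres_rel S R)"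
    by (auto simp: refl_on_def pres_rel_def intro: pres_refl)
  show "sym_on UNIV (pres_rel S R)"
    by (intro symI) (simp add: pres_rel_def, rule pres_sym)
  show "trans_on UNIV (pres_rel S R)"
    by (intro transI) (simp add: pres_rel_def, rule pres_trans)
qed

lemma presented_group_mult:
  assumes "v \<in> words S" "w \<in> words S"
  shows "pres_rel S R `` {v} \<otimes>\<^bsub>presented_group S R\<^esub> pres_rel S R `` {w} = pres_rel S R `` {v @ w}"
proof -
  let ?A = "pres_rel S R `` {v}" and ?B = "pres_rel S R `` {w}" and ?C = "pres_rel S R `` {v @ w}"
  have eq: "pres_rel S R `` {a @ b} = ?C" if "a \<in> ?A" "b \<in> ?B" for a b
  proof (rule equiv_class_eq[OF equiv_pres_rel, symmetric])
    have "pres_cong S R v a" "pres_cong S R w b"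
      using that by (simp_all add: pres_rel_def)
    then show "(v @ w, a @ b) \<in> pres_rel S R"
      by (simp add: pres_rel_def pres_cong_append)
  qed
  have ne: "v \<in> ?A" "w \<in> ?B"
    using assms equiv_class_self[OF equiv_pres_rel] by auto
  have "(\<Union>a\<in>?A. \<Union>b\<in>?B. pres_rel S R `` {a @ b}) = (\<Union>a\<in>?A. \<Union>b\<in>?B. ?C)"
    by (intro SUP_cong refl eq)
  also have "\<dots> = ?C"
    using ne by blast
  finally show ?thesis
    by (simp add: presented_group_def)
qed

lemma pres_cong_inverse:
  "w \<in> words S \<Longrightarrow> pres_cong S R (rev (map (\<lambda>(s, b). (s, \<not> b)) w) @ w) []"
proof (induction w)
  case Nil
  then show ?case by (simp add: pres_refl)
next
  case (Cons x w)
  obtain s b where x: "x = (s, b)" by force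
  have inv: "rev (map (\<lambda>(s, b). (s, \<not> b)) w) \<in> words S"
    using Cons.prems by (auto simp: words_def)
  have "pres_cong S R (rev (map (\<lambda>(s, b). (s, \<not> b)) w) @ [(s, \<not> b), (s, \<not> \<not> b)] @ w)
    (rev (map (\<lambda>(s, b). (s, \<not> b)) w) @ w)"
    using Cons.prems inv x by (intro pres_cancel) auto
  then have "pres_cong S R (rev (map (\<lambda>(s, b). (s, \<not> b)) (x # w)) @ x # w)
      (rev (map (\<lambda>(s, b). (s, \<not> b)) w) @ w)"
    by (simp add: x)
  also have "pres_cong S R (rev (map (\<lambda>(s, b). (s, \<not> b)) w) @ w) []"
    using Cons by simp
  finally (pres_trans) show ?case .
qed

lemma group_presented_group: "group (presented_group S R)"
proof (rule groupI)
  let ?G = "presented_group S R" and ?c = "\<lambda>w. pres_rel S R `` {w}"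
  have car: "carrier ?G = ?c ` words S"
    by (auto simp: presented_group_def quotient_def)
  have one: "\<one>\<^bsub>?G\<^esub> = ?c []"
    by (simp add: presented_group_def)
  show "\<one>\<^bsub>?G\<^esub> \<in> carrier ?G"
    by (auto simp: car one)
  show "x \<otimes>\<^bsub>?G\<^esub> y \<in> carrier ?G" if "x \<in> carrier ?G" "y \<in> carrier ?G" for x y
    using that by (auto simp: car presented_group_mult)
  show "x \<otimes>\<^bsub>?G\<^esub> y \<otimes>\<^bsub>?G\<^esub> z = x \<otimes>\<^bsub>?G\<^esub> (y \<otimes>\<^bsub>?G\<^esub> z)"
    if "x \<in> carrier ?G" "y \<in> carrier ?G" "z \<in> carrier ?G" for x y z
    using that by (auto simp: car presented_group_mult)
  show "\<one>\<^bsub>?G\<^esub> \<otimes>\<^bsub>?G\<^esub> x = x" if "x \<in> carrier ?G" for x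
    using that by (auto simp: car one presented_group_mult)
  show "\<exists>y\<in>carrier ?G. y \<otimes>\<^bsub>?G\<^esub> x = \<one>\<^bsub>?G\<^esub>" if "x \<in> carrier ?G" for x
  proof -
    from that obtain w where w: "w \<in> words S" "x = ?c w" by (auto simp: car)
    let ?v = "rev (map (\<lambda>(s, b). (s, \<not> b)) w)"
    have v: "?v \<in> words S" using w by (auto simp: words_def)
    have "?c (?v @ w) = ?c []"
      using pres_cong_inverse[OF w(1)]
      by (intro equiv_class_eq[OF equiv_pres_rel]) (simp add: pres_rel_def)
    then have "?c ?v \<otimes>\<^bsub>?G\<^esub> x = \<one>\<^bsub>?G\<^esub>"
      using v w by (simp add: presented_group_mult one)
    then show ?thesis using v by (auto simp: car)
  qed
qed


section \<open>Free groups and ascending HNN extensions\<close>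

text \<open>The basis \<open>X\<close> may have any cardinality.  Taking \<open>X\<close> in the element type of \<open>F\<close> is no
  restriction, since a basis of a free group embeds into the group.\<close>

definition is_free_group :: "('a, 'b) monoid_scheme \<Rightarrow> bool"
  where "is_free_group F \<longleftrightarrow> group F \<and> (\<exists>X :: 'a set. F \<cong> presented_group X {})"

text \<open>\<open>F\<close> enters the presentation \<open>\<langle>F, t | t\<inverse> f t = \<phi> f (f \<in> F)\<rangle>\<close> through its multiplication
  table: every element of \<open>F\<close> is a generator, and every product that holds in \<open>F\<close> is a
  relation.\<close>

datatype 'a hnn_gen = Base 'a | Stable

definition ascending_hnn :: "('a, 'b) monoid_scheme \<Rightarrow> ('a \<Rightarrow> 'a) \<Rightarrow> 'a hnn_gen word set monoid"
  where "ascending_hnn F \<phi> = presented_group (insert Stable (Base ` carrier F))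
    ({([(Base f, True), (Base g, True)], [(Base (f \<otimes>\<^bsub>F\<^esub> g), True)]) |f g.
        f \<in> carrier F \<and> g \<in> carrier F} \<union>
     {([(Stable, False), (Base f, True), (Stable, True)], [(Base (\<phi> f), True)]) |f.
        f \<in> carrier F})"


section \<open>Group rings\<close>

text \<open>Elements are the finitely supported functions on \<open>G\<close>, extended by \<open>\<zero>\<close> outside the carrier.
  The product is convolution, with \<open>(a b) x = (\<Sum>y. a y \<cdot> b (y\<inverse> x))\<close>.\<close>

definition support :: "('k, 'm) ring_scheme \<Rightarrow> ('g \<Rightarrow> 'k) \<Rightarrow> 'g set"
  where "support K a = {x. a x \<noteq> \<zero>\<^bsub>K\<^esub>}"

definition group_ring :: "('k, 'm) ring_scheme \<Rightarrow> ('g, 'n) monoid_scheme \<Rightarrow> ('g \<Rightarrow> 'k) ring"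
  where "group_ring K G =
    \<lparr>carrier = {a. range a \<subseteq> carrier K \<and> support K a \<subseteq> carrier G \<and> finite (support K a)},
     monoid.mult = (\<lambda>a b x. if x \<in> carrier G
        then \<Oplus>\<^bsub>K\<^esub>y\<in>support K a. a y \<otimes>\<^bsub>K\<^esub> b (inv\<^bsub>G\<^esub> y \<otimes>\<^bsub>G\<^esub> x) else \<zero>\<^bsub>K\<^esub>),
     one = (\<lambda>x. if x = \<one>\<^bsub>G\<^esub> then \<one>\<^bsub>K\<^esub> else \<zero>\<^bsub>K\<^esub>),
     zero = (\<lambda>x. \<zero>\<^bsub>K\<^esub>),
     add = (\<lambda>a b x. a x \<oplus>\<^bsub>K\<^esub> b x)\<rparr>"

lemma (in abelian_monoid) finsum_comm:
  assumes "finite A" "finite B" "\<And>x y. x \<in> A \<Longrightarrow> y \<in> B \<Longrightarrow> h x y \<in> carrier G"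
  shows "(\<Oplus>x\<in>A. \<Oplus>y\<in>B. h x y) = (\<Oplus>y\<in>B. \<Oplus>x\<in>A. h x y)"
  using assms(1,3)
proof (induction A rule: finite_induct)
  case empty
  then show ?case by simp
next
  case (insert a A)
  have "(\<Oplus>x\<in>insert a A. \<Oplus>y\<in>B. h x y) = (\<Oplus>y\<in>B. h a y) \<oplus> (\<Oplus>y\<in>B. \<Oplus>x\<in>A. h x y)"
    using insert by (subst finsum_insert) (auto intro!: finsum_closed)
  also have "\<dots> = (\<Oplus>y\<in>B. h a y \<oplus> (\<Oplus>x\<in>A. h x y))"
    using insert by (subst finsum_addf) (auto intro!: finsum_closed)
  also have "\<dots> = (\<Oplus>y\<in>B. \<Oplus>x\<in>insert a A. h x y)"
    using insert by (intro finsum_cong') (auto simp: finsum_insert Pi_iff intro!: finsum_closed)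
  finally show ?case .
qed

lemma group_ring_mult_superset:
  assumes "ring K" "group G" "a \<in> carrier (group_ring K G)" "b \<in> carrier (group_ring K G)"
    and "finite A" "support K a \<subseteq> A" "x \<in> carrier G"
  shows "(a \<otimes>\<^bsub>group_ring K G\<^esub> b) x = (\<Oplus>\<^bsub>K\<^esub>y\<in>A. a y \<otimes>\<^bsub>K\<^esub> b (inv\<^bsub>G\<^esub> y \<otimes>\<^bsub>G\<^esub> x))"
proof -
  interpret K: ring K by fact
  have "a y \<in> carrier K" "b y \<in> carrier K" for y
    using assms by (auto simp: group_ring_def)
  then have "(\<Oplus>\<^bsub>K\<^esub>y\<in>support K a. a y \<otimes>\<^bsub>K\<^esub> b (inv\<^bsub>G\<^esub> y \<otimes>\<^bsub>G\<^esub> x)) =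
      (\<Oplus>\<^bsub>K\<^esub>y\<in>A. a y \<otimes>\<^bsub>K\<^esub> b (inv\<^bsub>G\<^esub> y \<otimes>\<^bsub>G\<^esub> x))"
    using assms by (intro K.add.finprod_mono_neutral_cong_left) (auto simp: support_def)
  then show ?thesis using assms by (simp add: group_ring_def)
qed

lemma group_ring_mult_closed:
  assumes "ring K" "group G" "a \<in> carrier (group_ring K G)" "b \<in> carrier (group_ring K G)"
  shows "a \<otimes>\<^bsub>group_ring K G\<^esub> b \<in> carrier (group_ring K G)"
    and "support K (a \<otimes>\<^bsub>group_ring K G\<^esub> b) \<subseteq> (\<lambda>(y, z). y \<otimes>\<^bsub>G\<^esub> z) ` (support K a \<times> support K b)"
proof -
  interpret K: ring K by fact
  interpret G: group G by fact
  let ?c = "a \<otimes>\<^bsub>group_ring K G\<^esub> b"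
  have vals: "a y \<in> carrier K" "b y \<in> carrier K" for y
    using assms by (auto simp: group_ring_def)
  have fin: "finite (support K a)" "finite (support K b)" "support K a \<subseteq> carrier G"
      "support K b \<subseteq> carrier G"
    using assms by (auto simp: group_ring_def)
  have c: "?c x = (if x \<in> carrier G
      then \<Oplus>\<^bsub>K\<^esub>y\<in>support K a. a y \<otimes>\<^bsub>K\<^esub> b (inv\<^bsub>G\<^esub> y \<otimes>\<^bsub>G\<^esub> x) else \<zero>\<^bsub>K\<^esub>)" for x
    by (simp add: group_ring_def)
  show supp: "support K ?c \<subseteq> (\<lambda>(y, z). y \<otimes>\<^bsub>G\<^esub> z) ` (support K a \<times> support K b)"
  proof
    fix x assume x: "x \<in> support K ?c"
    then have xG: "x \<in> carrier G" by (auto simp: support_def c split: if_splits)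
    have "\<exists>y\<in>support K a. inv\<^bsub>G\<^esub> y \<otimes>\<^bsub>G\<^esub> x \<in> support K b"
    proof (rule ccontr)
      assume "\<not> ?thesis"
      then have "?c x = \<zero>\<^bsub>K\<^esub>"
        using xG vals by (auto simp: c support_def intro!: K.add.finprod_one_eqI)
      with x show False by (simp add: support_def)
    qed
    then obtain y where y: "y \<in> support K a" "inv\<^bsub>G\<^esub> y \<otimes>\<^bsub>G\<^esub> x \<in> support K b" by blast
    then have "x = y \<otimes>\<^bsub>G\<^esub> (inv\<^bsub>G\<^esub> y \<otimes>\<^bsub>G\<^esub> x)"
      using xG fin by (auto simp: G.m_assoc[symmetric])
    with y show "x \<in> (\<lambda>(y, z). y \<otimes>\<^bsub>G\<^esub> z) ` (support K a \<times> support K b)" by force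
  qed
  have "finite (support K ?c)"
    using finite_subset[OF supp] fin by simp
  moreover have "support K ?c \<subseteq> carrier G"
    by (auto simp: support_def c split: if_splits)
  moreover have "range ?c \<subseteq> carrier K"
    using vals by (auto simp: c intro!: K.finsum_closed)
  ultimately show "?c \<in> carrier (group_ring K G)"
    by (simp add: group_ring_def)
qed

lemma ring_group_ring:
  fixes K (structure) and G (structure)
  assumes "ring K" "group G"
  shows "ring (group_ring K G)"
proof -
  interpret K: ring K by fact
  interpret G: group G by fact
  let ?R = "group_ring K G"
  have add: "(a \<oplus>\<^bsub>?R\<^esub> b) = (\<lambda>x. a x \<oplus>\<^bsub>K\<^esub> b x)" for a b
    by (simp add: group_ring_def)
  have zero: "\<zero>\<^bsub>?R\<^esub> = (\<lambda>x. \<zero>\<^bsub>K\<^esub>)"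
    by (simp add: group_ring_def)
  have one: "\<one>\<^bsub>?R\<^esub> = (\<lambda>x. if x = \<one>\<^bsub>G\<^esub> then \<one>\<^bsub>K\<^esub> else \<zero>\<^bsub>K\<^esub>)"
    by (simp add: group_ring_def)
  have mem: "a \<in> carrier ?R \<longleftrightarrow>
      (\<forall>x. a x \<in> carrier K) \<and> support K a \<subseteq> carrier G \<and> finite (support K a)" for a
    by (auto simp: group_ring_def)
  have out: "(a \<otimes>\<^bsub>?R\<^esub> b) x = \<zero>\<^bsub>K\<^esub>" if "x \<notin> carrier G" for a b x
    using that by (simp add: group_ring_def)
  note sup = group_ring_mult_superset[OF assms]
  note mult_closed = group_ring_mult_closed(1)[OF assms]
  have add_closed: "a \<oplus>\<^bsub>?R\<^esub> b \<in> carrier ?R" if "a \<in> carrier ?R" "b \<in> carrier ?R" for a b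
  proof -
    have "support K (a \<oplus>\<^bsub>?R\<^esub> b) \<subseteq> support K a \<union> support K b"
      using that by (auto simp: support_def add mem)
    moreover have "finite (support K a \<union> support K b)" "support K a \<union> support K b \<subseteq> carrier G"
      using that by (auto simp: mem)
    ultimately have "support K (a \<oplus>\<^bsub>?R\<^esub> b) \<subseteq> carrier G" "finite (support K (a \<oplus>\<^bsub>?R\<^esub> b))"
      by (auto intro: finite_subset)
    then show ?thesis using that by (auto simp: mem add)
  qed
  have one_closed: "\<one>\<^bsub>?R\<^esub> \<in> carrier ?R"
  proof -
    have "support K \<one>\<^bsub>?R\<^esub> \<subseteq> {\<one>\<^bsub>G\<^esub>}" by (auto simp: support_def one)
    then have "support K \<one>\<^bsub>?R\<^esub> \<subseteq> carrier G" "finite (support K \<one>\<^bsub>?R\<^esub>)"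
      by (auto intro: finite_subset)
    then show ?thesis by (auto simp: mem one)
  qed
  show ?thesis
  proof (rule ringI)
    show "abelian_group ?R"
    proof (rule abelian_groupI)
      show "\<exists>y\<in>carrier ?R. y \<oplus>\<^bsub>?R\<^esub> x = \<zero>\<^bsub>?R\<^esub>" if "x \<in> carrier ?R" for x
      proof (rule bexI)
        have "support K (\<lambda>z. \<ominus>\<^bsub>K\<^esub> x z) \<subseteq> support K x" by (auto simp: support_def)
        moreover have "finite (support K x)" "support K x \<subseteq> carrier G"
          using that by (auto simp: mem)
        ultimately have "support K (\<lambda>z. \<ominus>\<^bsub>K\<^esub> x z) \<subseteq> carrier G"
            "finite (support K (\<lambda>z. \<ominus>\<^bsub>K\<^esub> x z))"
          by (auto intro: finite_subset)
        then show "(\<lambda>z. \<ominus>\<^bsub>K\<^esub> x z) \<in> carrier ?R"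
          using that by (auto simp: mem)
        show "(\<lambda>z. \<ominus>\<^bsub>K\<^esub> x z) \<oplus>\<^bsub>?R\<^esub> x = \<zero>\<^bsub>?R\<^esub>"
          using that by (auto simp: add zero mem K.l_neg)
      qed
    qed (auto simp: add_closed, auto simp: add zero mem K.a_ac support_def)
    show "monoid ?R"
    proof (rule monoidI)
      show "\<one>\<^bsub>?R\<^esub> \<in> carrier ?R" by (rule one_closed)
      show "x \<otimes>\<^bsub>?R\<^esub> y \<in> carrier ?R" if "x \<in> carrier ?R" "y \<in> carrier ?R" for x y
        using mult_closed that by blast
      show "\<one>\<^bsub>?R\<^esub> \<otimes>\<^bsub>?R\<^esub> a = a" if a: "a \<in> carrier ?R" for a
      proof
        fix x
        show "(\<one>\<^bsub>?R\<^esub> \<otimes>\<^bsub>?R\<^esub> a) x = a x"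
        proof (cases "x \<in> carrier G")
          case True
          have "(\<one>\<^bsub>?R\<^esub> \<otimes>\<^bsub>?R\<^esub> a) x =
              (\<Oplus>\<^bsub>K\<^esub>y\<in>{\<one>\<^bsub>G\<^esub>}. \<one>\<^bsub>?R\<^esub> y \<otimes>\<^bsub>K\<^esub> a (inv\<^bsub>G\<^esub> y \<otimes>\<^bsub>G\<^esub> x))"
            by (intro sup) (use a one_closed True in \<open>auto simp: support_def one\<close>)
          also have "\<dots> = a x"
            using a True by (simp add: K.finsum_insert one mem)
          finally show ?thesis .
        next
          case False
          then have "a x = \<zero>\<^bsub>K\<^esub>" using a by (auto simp: mem support_def)
          with False show ?thesis by (simp add: out)
        qed
      qed
      show "a \<otimes>\<^bsub>?R\<^esub> \<one>\<^bsub>?R\<^esub> = a" if a: "a \<in> carrier ?R" for a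
      proof
        fix x
        show "(a \<otimes>\<^bsub>?R\<^esub> \<one>\<^bsub>?R\<^esub>) x = a x"
        proof (cases "x \<in> carrier G")
          case True
          let ?A = "insert x (support K a)"
          have fin: "finite ?A" and A: "?A \<subseteq> carrier G" using a True by (auto simp: mem)
          have "(a \<otimes>\<^bsub>?R\<^esub> \<one>\<^bsub>?R\<^esub>) x = (\<Oplus>\<^bsub>K\<^esub>y\<in>?A. a y \<otimes>\<^bsub>K\<^esub> \<one>\<^bsub>?R\<^esub> (inv\<^bsub>G\<^esub> y \<otimes>\<^bsub>G\<^esub> x))"
            by (intro sup) (use a one_closed True fin in auto)
          also have "\<dots> = (\<Oplus>\<^bsub>K\<^esub>y\<in>?A. if x = y then a y else \<zero>\<^bsub>K\<^esub>)"
          proof (rule K.finsum_cong')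
            show "a y \<otimes>\<^bsub>K\<^esub> \<one>\<^bsub>?R\<^esub> (inv\<^bsub>G\<^esub> y \<otimes>\<^bsub>G\<^esub> x) = (if x = y then a y else \<zero>\<^bsub>K\<^esub>)"
              if "y \<in> ?A" for y
            proof -
              have y: "y \<in> carrier G" using that A by blast
              have "inv\<^bsub>G\<^esub> y \<otimes>\<^bsub>G\<^esub> x = \<one>\<^bsub>G\<^esub> \<longleftrightarrow> x = y"
                using y True G.inv_solve_left[of "\<one>\<^bsub>G\<^esub>" y x] by auto
              then show ?thesis using a by (auto simp: one mem)
            qed
          qed (use a in \<open>auto simp: mem\<close>)
          also have "\<dots> = a x"
            using a fin by (subst K.finsum_singleton) (auto simp: mem)
          finally show ?thesis .
        next
          case False
          then have "a x = \<zero>\<^bsub>K\<^esub>" using a by (auto simp: mem support_def)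
          with False show ?thesis by (simp add: out)
        qed
      qed
      show "a \<otimes>\<^bsub>?R\<^esub> b \<otimes>\<^bsub>?R\<^esub> c = a \<otimes>\<^bsub>?R\<^esub> (b \<otimes>\<^bsub>?R\<^esub> c)"
        if a: "a \<in> carrier ?R" and b: "b \<in> carrier ?R" and c: "c \<in> carrier ?R" for a b c
      proof
        fix x
        show "(a \<otimes>\<^bsub>?R\<^esub> b \<otimes>\<^bsub>?R\<^esub> c) x = (a \<otimes>\<^bsub>?R\<^esub> (b \<otimes>\<^bsub>?R\<^esub> c)) x"
        proof (cases "x \<in> carrier G")
          case x: True
          let ?A = "support K a" and ?B = "support K b"
          let ?Z = "(\<lambda>(y, z). y \<otimes>\<^bsub>G\<^esub> z) ` (?A \<times> ?B)"
          have vals [simp]: "a y \<in> carrier K" "b y \<in> carrier K" "c y \<in> carrier K" for y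
            using a b c by (auto simp: mem)
          have fin: "finite ?A" "finite ?B" "finite ?Z" and AG: "?A \<subseteq> carrier G"
            and BG: "?B \<subseteq> carrier G"
            using a b by (auto simp: mem)
          have ZG: "?Z \<subseteq> carrier G" using AG BG by auto
          have "(a \<otimes>\<^bsub>?R\<^esub> b \<otimes>\<^bsub>?R\<^esub> c) x =
              (\<Oplus>\<^bsub>K\<^esub>z\<in>?Z. (a \<otimes>\<^bsub>?R\<^esub> b) z \<otimes>\<^bsub>K\<^esub> c (inv\<^bsub>G\<^esub> z \<otimes>\<^bsub>G\<^esub> x))"
            by (intro sup mult_closed a b c x fin group_ring_mult_closed(2)[OF assms])
          also have "\<dots> = (\<Oplus>\<^bsub>K\<^esub>z\<in>?Z. \<Oplus>\<^bsub>K\<^esub>y\<in>?A.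
              a y \<otimes>\<^bsub>K\<^esub> b (inv\<^bsub>G\<^esub> y \<otimes>\<^bsub>G\<^esub> z) \<otimes>\<^bsub>K\<^esub> c (inv\<^bsub>G\<^esub> z \<otimes>\<^bsub>G\<^esub> x))"
          proof (rule K.finsum_cong')
            fix z assume z: "z \<in> ?Z"
            have "(a \<otimes>\<^bsub>?R\<^esub> b) z = (\<Oplus>\<^bsub>K\<^esub>y\<in>?A. a y \<otimes>\<^bsub>K\<^esub> b (inv\<^bsub>G\<^esub> y \<otimes>\<^bsub>G\<^esub> z))"
              by (intro sup a b fin) (use z ZG in auto)
            then show "(a \<otimes>\<^bsub>?R\<^esub> b) z \<otimes>\<^bsub>K\<^esub> c (inv\<^bsub>G\<^esub> z \<otimes>\<^bsub>G\<^esub> x) = (\<Oplus>\<^bsub>K\<^esub>y\<in>?A.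
                a y \<otimes>\<^bsub>K\<^esub> b (inv\<^bsub>G\<^esub> y \<otimes>\<^bsub>G\<^esub> z) \<otimes>\<^bsub>K\<^esub> c (inv\<^bsub>G\<^esub> z \<otimes>\<^bsub>G\<^esub> x))"
              using fin by (simp add: K.finsum_ldistr)
          qed (auto intro!: K.finsum_closed)
          also have "\<dots> = (\<Oplus>\<^bsub>K\<^esub>y\<in>?A. \<Oplus>\<^bsub>K\<^esub>z\<in>?Z.
              a y \<otimes>\<^bsub>K\<^esub> b (inv\<^bsub>G\<^esub> y \<otimes>\<^bsub>G\<^esub> z) \<otimes>\<^bsub>K\<^esub> c (inv\<^bsub>G\<^esub> z \<otimes>\<^bsub>G\<^esub> x))"
            using fin by (intro K.finsum_comm) auto
          also have "\<dots> = (\<Oplus>\<^bsub>K\<^esub>y\<in>?A. a y \<otimes>\<^bsub>K\<^esub> (b \<otimes>\<^bsub>?R\<^esub> c) (inv\<^bsub>G\<^esub> y \<otimes>\<^bsub>G\<^esub> x))"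
          proof (rule K.finsum_cong')
            fix y assume y: "y \<in> ?A"
            with AG have yG [simp]: "y \<in> carrier G" by blast
            have inj: "inj_on (\<lambda>w. y \<otimes>\<^bsub>G\<^esub> w) ?B"
              using BG by (intro inj_onI) (auto simp: subset_iff)
            have "(\<Oplus>\<^bsub>K\<^esub>z\<in>?Z. a y \<otimes>\<^bsub>K\<^esub> b (inv\<^bsub>G\<^esub> y \<otimes>\<^bsub>G\<^esub> z) \<otimes>\<^bsub>K\<^esub> c (inv\<^bsub>G\<^esub> z \<otimes>\<^bsub>G\<^esub> x)) =
                (\<Oplus>\<^bsub>K\<^esub>z\<in>(\<lambda>w. y \<otimes>\<^bsub>G\<^esub> w) ` ?B.
                  a y \<otimes>\<^bsub>K\<^esub> b (inv\<^bsub>G\<^esub> y \<otimes>\<^bsub>G\<^esub> z) \<otimes>\<^bsub>K\<^esub> c (inv\<^bsub>G\<^esub> z \<otimes>\<^bsub>G\<^esub> x))"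
            proof (rule K.add.finprod_mono_neutral_cong_right)
              show "(\<lambda>w. y \<otimes>\<^bsub>G\<^esub> w) ` ?B \<subseteq> ?Z" using y by auto
              fix z assume z: "z \<in> ?Z - (\<lambda>w. y \<otimes>\<^bsub>G\<^esub> w) ` ?B"
              then have zG: "z \<in> carrier G" using ZG by blast
              have "z = y \<otimes>\<^bsub>G\<^esub> (inv\<^bsub>G\<^esub> y \<otimes>\<^bsub>G\<^esub> z)"
                using zG by (simp add: G.m_assoc[symmetric])
              then have "inv\<^bsub>G\<^esub> y \<otimes>\<^bsub>G\<^esub> z \<notin> ?B" using z by blast
              then show "a y \<otimes>\<^bsub>K\<^esub> b (inv\<^bsub>G\<^esub> y \<otimes>\<^bsub>G\<^esub> z) \<otimes>\<^bsub>K\<^esub> c (inv\<^bsub>G\<^esub> z \<otimes>\<^bsub>G\<^esub> x) = \<zero>\<^bsub>K\<^esub>"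
                by (simp add: support_def)
            qed (use fin in auto)
            also have "\<dots> = (\<Oplus>\<^bsub>K\<^esub>w\<in>?B. a y \<otimes>\<^bsub>K\<^esub> b (inv\<^bsub>G\<^esub> y \<otimes>\<^bsub>G\<^esub> (y \<otimes>\<^bsub>G\<^esub> w)) \<otimes>\<^bsub>K\<^esub>
                c (inv\<^bsub>G\<^esub> (y \<otimes>\<^bsub>G\<^esub> w) \<otimes>\<^bsub>G\<^esub> x))"
              using inj by (intro K.finsum_reindex) auto
            also have "\<dots> = (\<Oplus>\<^bsub>K\<^esub>w\<in>?B. a y \<otimes>\<^bsub>K\<^esub> (b w \<otimes>\<^bsub>K\<^esub>
                c (inv\<^bsub>G\<^esub> w \<otimes>\<^bsub>G\<^esub> (inv\<^bsub>G\<^esub> y \<otimes>\<^bsub>G\<^esub> x))))"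
            proof (rule K.finsum_cong')
              fix w assume "w \<in> ?B"
              then have w: "w \<in> carrier G" using BG by blast
              have "inv\<^bsub>G\<^esub> y \<otimes>\<^bsub>G\<^esub> (y \<otimes>\<^bsub>G\<^esub> w) = w"
                using w by (simp add: G.m_assoc[symmetric])
              moreover have "inv\<^bsub>G\<^esub> (y \<otimes>\<^bsub>G\<^esub> w) \<otimes>\<^bsub>G\<^esub> x = inv\<^bsub>G\<^esub> w \<otimes>\<^bsub>G\<^esub> (inv\<^bsub>G\<^esub> y \<otimes>\<^bsub>G\<^esub> x)"
                using w x by (simp add: G.inv_mult_group G.m_assoc)
              ultimately show "a y \<otimes>\<^bsub>K\<^esub> b (inv\<^bsub>G\<^esub> y \<otimes>\<^bsub>G\<^esub> (y \<otimes>\<^bsub>G\<^esub> w)) \<otimes>\<^bsub>K\<^esub>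
                  c (inv\<^bsub>G\<^esub> (y \<otimes>\<^bsub>G\<^esub> w) \<otimes>\<^bsub>G\<^esub> x) =
                  a y \<otimes>\<^bsub>K\<^esub> (b w \<otimes>\<^bsub>K\<^esub> c (inv\<^bsub>G\<^esub> w \<otimes>\<^bsub>G\<^esub> (inv\<^bsub>G\<^esub> y \<otimes>\<^bsub>G\<^esub> x)))"
                by (simp add: K.m_assoc)
            qed auto
            also have "\<dots> = a y \<otimes>\<^bsub>K\<^esub>
                (\<Oplus>\<^bsub>K\<^esub>w\<in>?B. b w \<otimes>\<^bsub>K\<^esub> c (inv\<^bsub>G\<^esub> w \<otimes>\<^bsub>G\<^esub> (inv\<^bsub>G\<^esub> y \<otimes>\<^bsub>G\<^esub> x)))"
              using fin by (simp add: K.finsum_rdistr)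
            also have "(\<Oplus>\<^bsub>K\<^esub>w\<in>?B. b w \<otimes>\<^bsub>K\<^esub> c (inv\<^bsub>G\<^esub> w \<otimes>\<^bsub>G\<^esub> (inv\<^bsub>G\<^esub> y \<otimes>\<^bsub>G\<^esub> x))) =
                (b \<otimes>\<^bsub>?R\<^esub> c) (inv\<^bsub>G\<^esub> y \<otimes>\<^bsub>G\<^esub> x)"
              by (intro sup[symmetric] b c fin) (use x in auto)
            finally show "(\<Oplus>\<^bsub>K\<^esub>z\<in>?Z.
                a y \<otimes>\<^bsub>K\<^esub> b (inv\<^bsub>G\<^esub> y \<otimes>\<^bsub>G\<^esub> z) \<otimes>\<^bsub>K\<^esub> c (inv\<^bsub>G\<^esub> z \<otimes>\<^bsub>G\<^esub> x)) =
                a y \<otimes>\<^bsub>K\<^esub> (b \<otimes>\<^bsub>?R\<^esub> c) (inv\<^bsub>G\<^esub> y \<otimes>\<^bsub>G\<^esub> x)" .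
          qed (use mult_closed[OF b c] in \<open>auto simp: mem\<close>)
          also have "\<dots> = (a \<otimes>\<^bsub>?R\<^esub> (b \<otimes>\<^bsub>?R\<^esub> c)) x"
            by (intro sup[symmetric] mult_closed a b c fin x) auto
          finally show ?thesis .
        next
          case False
          then show ?thesis by (simp add: out)
        qed
      qed
    qed
    show "(a \<oplus>\<^bsub>?R\<^esub> b) \<otimes>\<^bsub>?R\<^esub> c = a \<otimes>\<^bsub>?R\<^esub> c \<oplus>\<^bsub>?R\<^esub> b \<otimes>\<^bsub>?R\<^esub> c"
      if a: "a \<in> carrier ?R" and b: "b \<in> carrier ?R" and c: "c \<in> carrier ?R" for a b c
    proof
      fix x
      show "((a \<oplus>\<^bsub>?R\<^esub> b) \<otimes>\<^bsub>?R\<^esub> c) x = (a \<otimes>\<^bsub>?R\<^esub> c \<oplus>\<^bsub>?R\<^esub> b \<otimes>\<^bsub>?R\<^esub> c) x"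
      proof (cases "x \<in> carrier G")
        case x: True
        let ?A = "support K a \<union> support K b"
        have vals: "a y \<in> carrier K" "b y \<in> carrier K" "c y \<in> carrier K" for y
          using a b c by (auto simp: mem)
        have A: "finite ?A" using a b by (auto simp: mem)
        have *: "((a \<oplus>\<^bsub>?R\<^esub> b) \<otimes>\<^bsub>?R\<^esub> c) x =
            (\<Oplus>\<^bsub>K\<^esub>y\<in>?A. (a \<oplus>\<^bsub>?R\<^esub> b) y \<otimes>\<^bsub>K\<^esub> c (inv\<^bsub>G\<^esub> y \<otimes>\<^bsub>G\<^esub> x))"
          by (intro sup add_closed a b c A x) (use vals in \<open>auto simp: support_def add\<close>)
        show ?thesis
          unfolding * unfolding add sup[OF a c A Un_upper1 x] sup[OF b c A Un_upper2 x]
          using vals by (simp add: K.l_distr K.finsum_addf)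
      next
        case False
        then show ?thesis by (simp add: out add)
      qed
    qed
    show "c \<otimes>\<^bsub>?R\<^esub> (a \<oplus>\<^bsub>?R\<^esub> b) = c \<otimes>\<^bsub>?R\<^esub> a \<oplus>\<^bsub>?R\<^esub> c \<otimes>\<^bsub>?R\<^esub> b"
      if a: "a \<in> carrier ?R" and b: "b \<in> carrier ?R" and c: "c \<in> carrier ?R" for a b c
    proof
      fix x
      show "(c \<otimes>\<^bsub>?R\<^esub> (a \<oplus>\<^bsub>?R\<^esub> b)) x = (c \<otimes>\<^bsub>?R\<^esub> a \<oplus>\<^bsub>?R\<^esub> c \<otimes>\<^bsub>?R\<^esub> b) x"
      proof (cases "x \<in> carrier G")
        case x: True
        have vals: "a y \<in> carrier K" "b y \<in> carrier K" "c y \<in> carrier K" for y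
          using a b c by (auto simp: mem)
        have A: "finite (support K c)" using c by (auto simp: mem)
        show ?thesis
          unfolding add sup[OF c add_closed[OF a b] A order.refl x, unfolded add]
            sup[OF c a A order.refl x] sup[OF c b A order.refl x]
          using vals by (simp add: K.r_distr K.finsum_addf)
      next
        case False
        then show ?thesis by (simp add: out add)
      qed
    qed
  qed
qed


section \<open>The Jacobson radical\<close>

text \<open>The ideals of the library are two-sided; for a noncommutative ring the Jacobson radical is
  the intersection of the maximal left ideals.\<close>

definition left_ideal :: "'r set \<Rightarrow> ('r, 'm) ring_scheme \<Rightarrow> bool"
  where "left_ideal I R \<longleftrightarrow> additive_subgroup I R \<and>
    (\<forall>r\<in>carrier R. \<forall>x\<in>I. r \<otimes>\<^bsub>R\<^esub> x \<in> I)"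

definition maximal_left_ideal :: "'r set \<Rightarrow> ('r, 'm) ring_scheme \<Rightarrow> bool"
  where "maximal_left_ideal I R \<longleftrightarrow> left_ideal I R \<and> I \<noteq> carrier R \<and>
    (\<forall>J. left_ideal J R \<and> I \<subseteq> J \<longrightarrow> J = I \<or> J = carrier R)"

definition jacobson_radical :: "('r, 'm) ring_scheme \<Rightarrow> 'r set"
  where "jacobson_radical R = {x \<in> carrier R. \<forall>I. maximal_left_ideal I R \<longrightarrow> x \<in> I}"

definition semiprimitive :: "('r, 'm) ring_scheme \<Rightarrow> bool"
  where "semiprimitive R \<longleftrightarrow> jacobson_radical R = {\<zero>\<^bsub>R\<^esub>}"

end

theory Submission
  imports Defs "HOL-Algebra.Bij" "HOL-Algebra.Elementary_Groups"
begin

text \<open>Let \<open>G = F\<^sub>\<phi>\<close>.  Every element of \<open>G\<close> has the form \<open>t\<^sup>a f t\<^sup>-\<^sup>b\<close>, and \<open>G\<close> maps onto the integers by the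
  exponent of \<open>t\<close>; the kernel is the ascending union of the conjugates \<open>t\<^sup>n F t\<^sup>-\<^sup>n\<close>.  A positive
  cone of \<open>F\<close>, transported to \<open>t\<^sup>n F t\<^sup>-\<^sup>n\<close> with \<open>n\<close> large, together with the elements of positive
  degree, is closed under products and compares any finitely many given elements of \<open>G\<close>.  If
  \<open>c a = 1\<close> in the group ring, the largest and the smallest element of
  \<open>support c \<cdot> support a\<close> are then uniquely represented as products, so they both occur in the support of
  \<open>c a\<close>, and \<open>a\<close> is supported at a single element.  A nonzero \<open>x\<close> in the Jacobson radical would
  make every \<open>1 - g x\<close> left invertible, but since \<open>G\<close> is infinite some \<open>g\<close> gives it at least two
  support elements.

  Free groups are ordered by the signed count of edges and turns along paths in the Cayley tree
  (Sunic): it is odd, hence nonzero, for nontrivial elements, and additive up to an error of at most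
  \<open>1\<close>.\<close>

section \<open>Positive cones\<close>

text \<open>For \<open>D = carrier G\<close> this is the positive cone of a left-invariant order, u
  lying below v when u^-1 v is in \<open>P\<close>. Comparability is demanded on \<open>D\<close>
  only, so the cone may be chosen after the elements that it has to compare.\<close>

definition positive_cone :: "('g, 'n) monoid_scheme \<Rightarrow> 'g set \<Rightarrow> 'g set \<Rightarrow> bool"
  where "positive_cone G D P \<longleftrightarrow> P \<subseteq> carrier G \<and> (\<forall>x\<in>P. \<forall>y\<in>P. x \<otimes>\<^bsub>G\<^esub> y \<in> P) \<and> \<one>\<^bsub>G\<^esub> \<notin> P \<and>
    (\<forall>x\<in>D. x = \<one>\<^bsub>G\<^esub> \<or> x \<in> P \<or> inv\<^bsub>G\<^esub> x \<in> P)"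

definition left_orderable :: "('g, 'n) monoid_scheme \<Rightarrow> bool"
  where "left_orderable G \<longleftrightarrow> (\<exists>P. positive_cone G (carrier G) P)"

definition locally_left_orderable :: "('g, 'n) monoid_scheme \<Rightarrow> bool"
  where "locally_left_orderable G \<longleftrightarrow>
    (\<forall>D. finite D \<and> D \<subseteq> carrier G \<longrightarrow> (\<exists>P. positive_cone G D P))"

text \<open>Passing to inverses reverses the order, so that a statement about maxima also yields the
  one about minima.\<close>

lemma (in group) positive_cone_inverse:
  assumes "positive_cone G D P" "D \<subseteq> carrier G"
  shows "positive_cone G D (m_inv G ` P)"
  unfolding positive_cone_def
proof (intro conjI ballI)
  have P: "P \<subseteq> carrier G" "\<And>x y. x \<in> P \<Longrightarrow> y \<in> P \<Longrightarrow> x \<otimes> y \<in> P" "\<one> \<notin> P"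
    "\<And>x. x \<in> D \<Longrightarrow> x = \<one> \<or> x \<in> P \<or> inv x \<in> P"
    using assms(1) by (auto simp: positive_cone_def)
  show "m_inv G ` P \<subseteq> carrier G"
    using P(1) by auto
  show "x \<otimes> y \<in> m_inv G ` P" if "x \<in> m_inv G ` P" "y \<in> m_inv G ` P" for x y
  proof -
    from that obtain u v where "u \<in> P" "v \<in> P" "x = inv u" "y = inv v" by blast
    then show ?thesis
      using P(1,2) by (auto simp: inv_mult_group[symmetric] subset_iff)
  qed
  show "\<one> \<notin> m_inv G ` P"
  proof
    assume "\<one> \<in> m_inv G ` P"
    then obtain u where "u \<in> P" "inv u = \<one>" by force
    then show False
      using P(1,3) inv_eq_1_iff by blast
  qed
  show "x = \<one> \<or> x \<in> m_inv G ` P \<or> inv x \<in> m_inv G ` P" if "x \<in> D" for x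
  proof -
    have "x = inv (inv x)"
      using that assms(2) by auto
    then show ?thesis
      using P(4)[OF that] by blast
  qed
qed

text \<open>The preimage of a cone is a cone; by injectivity only the identity is sent to the
  identity, so all other elements remain comparable with it.\<close>

lemma left_orderable_inj_hom:
  assumes "group F" "group H" "e \<in> hom F H" "inj_on e (carrier F)" "left_orderable H"
  shows "left_orderable F"
proof -
  interpret F: group F by fact
  interpret H: group H by fact
  interpret e: group_hom F H e
    using assms by (simp add: group_hom_def group_hom_axioms_def)
  obtain P where P: "positive_cone H (carrier H) P"
    using assms by (auto simp: left_orderable_def)
  have one: "x = \<one>\<^bsub>F\<^esub>" if "x \<in> carrier F" "e x = \<one>\<^bsub>H\<^esub>" for x
    using that assms(4) by (metis F.one_closed e.hom_one inj_onD)
  have "x = \<one>\<^bsub>F\<^esub> \<or> e x \<in> P \<or> e (inv\<^bsub>F\<^esub> x) \<in> P" if "x \<in> carrier F" for x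
  proof -
    have "e x = \<one>\<^bsub>H\<^esub> \<or> e x \<in> P \<or> inv\<^bsub>H\<^esub> (e x) \<in> P"
      using P e.hom_closed[OF that] unfolding positive_cone_def by blast
    then show ?thesis
      using one[OF that] that by auto
  qed
  then have "positive_cone F (carrier F) {x \<in> carrier F. e x \<in> P}"
    using P by (auto simp: positive_cone_def)
  then show ?thesis
    by (auto simp: left_orderable_def)
qed

section \<open>Left ideals and left invertibility\<close>

lemma (in ring) left_ideal_principal:
  assumes "a \<in> carrier R"
  shows "left_ideal ((\<lambda>c. c \<otimes> a) ` carrier R) R"
  unfolding left_ideal_def
proof (intro conjI ballI)
  show "additive_subgroup ((\<lambda>c. c \<otimes> a) ` carrier R) R"
  proof (rule additive_subgroupI, rule add.subgroupI)
    show "\<ominus> x \<in> (\<lambda>c. c \<otimes> a) ` carrier R" if "x \<in> (\<lambda>c. c \<otimes> a) ` carrier R" for x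
    proof -
      from that obtain c where "c \<in> carrier R" "x = c \<otimes> a" by blast
      then show ?thesis
        using assms by (intro image_eqI[of _ _ "\<ominus> c"]) (simp_all add: l_minus)
    qed
    show "x \<oplus> y \<in> (\<lambda>c. c \<otimes> a) ` carrier R"
      if "x \<in> (\<lambda>c. c \<otimes> a) ` carrier R" "y \<in> (\<lambda>c. c \<otimes> a) ` carrier R" for x y
    proof -
      from that obtain c d where "c \<in> carrier R" "x = c \<otimes> a" "d \<in> carrier R" "y = d \<otimes> a" by blast
      then show ?thesis
        using assms by (intro image_eqI[of _ _ "c \<oplus> d"]) (simp_all add: l_distr)
    qed
  qed (use assms in auto)
  show "r \<otimes> x \<in> (\<lambda>c. c \<otimes> a) ` carrier R"
    if "r \<in> carrier R" "x \<in> (\<lambda>c. c \<otimes> a) ` carrier R" for r x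
  proof -
    from that obtain c where "c \<in> carrier R" "x = c \<otimes> a" by blast
    then show ?thesis
      using assms that(1) by (intro image_eqI[of _ _ "r \<otimes> c"]) (simp_all add: m_assoc)
  qed
qed

lemma (in ring) left_ideal_eq_carrier:
  assumes "left_ideal I R" "\<one> \<in> I"
  shows "I = carrier R"
proof
  show "I \<subseteq> carrier R"
    using assms(1) additive_subgroup.a_subset by (auto simp: left_ideal_def)
  show "carrier R \<subseteq> I"
    using assms unfolding left_ideal_def by (metis r_one subsetI)
qed

lemma (in ring) left_ideal_Union_chain:
  assumes "\<C> \<noteq> {}" "\<And>I. I \<in> \<C> \<Longrightarrow> left_ideal I R" "\<And>I J. I \<in> \<C> \<Longrightarrow> J \<in> \<C> \<Longrightarrow> I \<subseteq> J \<or> J \<subseteq> I"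
  shows "left_ideal (\<Union>\<C>) R"
  unfolding left_ideal_def
proof (intro conjI ballI)
  have sub: "additive_subgroup I R" if "I \<in> \<C>" for I
    using assms(2)[OF that] by (simp add: left_ideal_def)
  show "additive_subgroup (\<Union>\<C>) R"
  proof (rule additive_subgroupI, rule add.subgroupI)
    show "\<Union>\<C> \<subseteq> carrier R"
      using sub additive_subgroup.a_subset by blast
    show "\<Union>\<C> \<noteq> {}"
      using assms(1) sub additive_subgroup.zero_closed by blast
    show "\<ominus> x \<in> \<Union>\<C>" if "x \<in> \<Union>\<C>" for x
    proof -
      from that obtain I where I: "I \<in> \<C>" "x \<in> I" by blast
      then interpret additive_subgroup I R
        using sub by simp
      show ?thesis
        using I a_inv_closed by blast
    qed
    show "x \<oplus> y \<in> \<Union>\<C>" if "x \<in> \<Union>\<C>" "y \<in> \<Union>\<C>" for x y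
    proof -
      from that obtain I J where "I \<in> \<C>" "J \<in> \<C>" "x \<in> I" "y \<in> J" by blast
      then obtain L where L: "L \<in> \<C>" "x \<in> L" "y \<in> L"
        using assms(3)[of I J] by blast
      then interpret additive_subgroup L R
        using sub by simp
      show ?thesis
        using L a_closed by blast
    qed
  qed
  show "r \<otimes> x \<in> \<Union>\<C>" if "r \<in> carrier R" "x \<in> \<Union>\<C>" for r x
    using that assms(2) by (auto simp: left_ideal_def)
qed

text \<open>Zorn's lemma applies because properness of a left ideal is the condition
  \<open>\<one> \<notin> J\<close>, which passes to unions of chains.\<close>

lemma (in ring) proper_left_ideal_maximal:
  assumes I: "left_ideal I R" "\<one> \<notin> I"
  shows "\<exists>M. maximal_left_ideal M R \<and> I \<subseteq> M"
proof -
  let ?\<A> = "{J. left_ideal J R \<and> I \<subseteq> J \<and> \<one> \<notin> J}"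
  have "\<exists>M\<in>?\<A>. \<forall>X\<in>?\<A>. M \<subseteq> X \<longrightarrow> X = M"
  proof (rule subset_Zorn_nonempty)
    show "?\<A> \<noteq> {}"
      using I by blast
    show "\<Union>\<C> \<in> ?\<A>" if "\<C> \<noteq> {}" "subset.chain ?\<A> \<C>" for \<C>
    proof -
      have "left_ideal (\<Union>\<C>) R"
        using that by (intro left_ideal_Union_chain) (auto simp: subset_chain_def)
      then show ?thesis
        using that by (fastforce simp: subset_chain_def)
    qed
  qed
  then obtain M where M: "left_ideal M R" "I \<subseteq> M" "\<one> \<notin> M"
    and max: "\<forall>X\<in>?\<A>. M \<subseteq> X \<longrightarrow> X = M"
    by (elim bexE) auto
  have "J = M \<or> J = carrier R" if "left_ideal J R" "M \<subseteq> J" for J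
    using that M left_ideal_eq_carrier[of J] max by blast
  moreover have "M \<noteq> carrier R"
    using M by blast
  ultimately have "maximal_left_ideal M R"
    using M(1) unfolding maximal_left_ideal_def by blast
  then show ?thesis
    using M(2) by blast
qed

text \<open>Otherwise the left ideal generated by \<open>\<one> \<ominus> r \<otimes> x\<close> is
  proper, and a maximal left ideal above it also contains \<open>r \<otimes> x\<close>, hence
  \<open>\<one>\<close>.\<close>

lemma (in ring) jacobson_radical_left_invertible:
  assumes x: "x \<in> jacobson_radical R" and r: "r \<in> carrier R"
  shows "\<exists>c\<in>carrier R. c \<otimes> (\<one> \<ominus> r \<otimes> x) = \<one>"
proof (rule ccontr)
  assume no_inverse: "\<not> ?thesis"
  have xR: "x \<in> carrier R"
    using x by (simp add: jacobson_radical_def)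
  let ?a = "\<one> \<ominus> r \<otimes> x"
  have a: "?a \<in> carrier R"
    using xR r by simp
  obtain M where M: "maximal_left_ideal M R" "(\<lambda>c. c \<otimes> ?a) ` carrier R \<subseteq> M"
    using proper_left_ideal_maximal[OF left_ideal_principal[OF a]] no_inverse by fastforce
  then have M_left: "left_ideal M R" and "M \<noteq> carrier R"
    by (auto simp: maximal_left_ideal_def)
  interpret M: additive_subgroup M R
    using M_left by (simp add: left_ideal_def)
  have "?a \<in> M"
    using M(2) a by (metis image_subset_iff l_one one_closed)
  moreover have "r \<otimes> x \<in> M"
    using x M(1) M_left r by (auto simp: jacobson_radical_def left_ideal_def)
  ultimately have "?a \<oplus> r \<otimes> x \<in> M"
    by (rule M.a_closed)
  moreover have "?a \<oplus> r \<otimes> x = \<one>"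
    using xR r by (simp add: minus_eq a_assoc l_neg)
  ultimately show False
    using left_ideal_eq_carrier[OF M_left] \<open>M \<noteq> carrier R\<close> by simp
qed

section \<open>Group rings of locally left-orderable groups\<close>

lemma finite_maximal_element:
  assumes "finite A" "A \<noteq> {}" "\<And>x. x \<in> A \<Longrightarrow> \<not> r x x"
    and "\<And>x y z. x \<in> A \<Longrightarrow> y \<in> A \<Longrightarrow> z \<in> A \<Longrightarrow> r x y \<Longrightarrow> r y z \<Longrightarrow> r x z"
  shows "\<exists>m\<in>A. \<forall>x\<in>A. \<not> r m x"
  using assms
proof (induction A rule: finite_ne_induct)
  case (insert a A)
  have "\<exists>m\<in>A. \<forall>x\<in>A. \<not> r m x"
    by (rule insert.IH) (use insert.prems in blast)+
  then obtain m where "m \<in> A" "\<forall>x\<in>A. \<not> r m x" by blast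
  then show ?case
    using insert.prems by (cases "r m a") (metis insert_iff)+
next
  case (singleton a)
  then show ?case by blast
qed

text \<open>The maximum \<open>m\<close> of \<open>S\<close> is a product of support elements in
  only one way, so its coefficient in the convolution is a single product of two nonzero field
  elements. The cone has to compare only quotients of elements of the finite set
  \<open>S\<close>.\<close>

lemma product_support_maximum:
  fixes K (structure) and G (structure)
  assumes K: "field K" and G: "group G"
    and c: "c \<in> carrier (group_ring K G)" and a: "a \<in> carrier (group_ring K G)"
    and C: "support K c \<noteq> {}" and A: "support K a \<noteq> {}"
    and S: "S = (\<lambda>(y, z). y \<otimes>\<^bsub>G\<^esub> z) ` (support K c \<times> support K a)"
    and P: "positive_cone G ((\<lambda>(u, v). inv\<^bsub>G\<^esub> u \<otimes>\<^bsub>G\<^esub> v) ` (S \<times> S)) P"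
  shows "\<exists>m\<in>S. (\<forall>x\<in>S. x = m \<or> inv\<^bsub>G\<^esub> x \<otimes>\<^bsub>G\<^esub> m \<in> P) \<and> (c \<otimes>\<^bsub>group_ring K G\<^esub> a) m \<noteq> \<zero>\<^bsub>K\<^esub>"
proof -
  interpret K: field K by fact
  interpret G: group G by fact
  define less where "less u v \<longleftrightarrow> inv\<^bsub>G\<^esub> u \<otimes>\<^bsub>G\<^esub> v \<in> P" for u v
  have P_mult: "x \<otimes>\<^bsub>G\<^esub> y \<in> P" if "x \<in> P" "y \<in> P" for x y
    using P that by (auto simp: positive_cone_def)
  have P_one: "\<one>\<^bsub>G\<^esub> \<notin> P"
    using P by (auto simp: positive_cone_def)
  have vals: "c y \<in> carrier K" "a y \<in> carrier K" for y
    using c a by (auto simp: group_ring_def)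
  have supp: "finite (support K c)" "finite (support K a)"
      "support K c \<subseteq> carrier G" "support K a \<subseteq> carrier G"
    using c a by (auto simp: group_ring_def)
  have SG: "S \<subseteq> carrier G"
    unfolding S using supp by auto
  have irrefl: "\<not> less u u" if "u \<in> carrier G" for u
    using that P_one by (simp add: less_def)
  have trans: "less u w" if "less u v" "less v w" "u \<in> carrier G" "v \<in> carrier G" "w \<in> carrier G"
    for u v w
  proof -
    have "(inv\<^bsub>G\<^esub> u \<otimes>\<^bsub>G\<^esub> v) \<otimes>\<^bsub>G\<^esub> (inv\<^bsub>G\<^esub> v \<otimes>\<^bsub>G\<^esub> w) = inv\<^bsub>G\<^esub> u \<otimes>\<^bsub>G\<^esub> w"
      using that(3-) by (simp add: G.m_assoc[symmetric]) (simp add: G.m_assoc)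
    then show ?thesis
      using P_mult that(1,2) by (metis less_def)
  qed
  have total: "u = v \<or> less u v \<or> less v u" if "u \<in> S" "v \<in> S" for u v
  proof -
    have uv: "u \<in> carrier G" "v \<in> carrier G"
      using that SG by auto
    have "inv\<^bsub>G\<^esub> u \<otimes>\<^bsub>G\<^esub> v = \<one>\<^bsub>G\<^esub> \<or> inv\<^bsub>G\<^esub> u \<otimes>\<^bsub>G\<^esub> v \<in> P \<or> inv\<^bsub>G\<^esub> (inv\<^bsub>G\<^esub> u \<otimes>\<^bsub>G\<^esub> v) \<in> P"
      using P that by (auto simp: positive_cone_def)
    moreover have "inv\<^bsub>G\<^esub> (inv\<^bsub>G\<^esub> u \<otimes>\<^bsub>G\<^esub> v) = inv\<^bsub>G\<^esub> v \<otimes>\<^bsub>G\<^esub> u"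
      using uv by (simp add: G.inv_mult_group)
    moreover have "u = v" if "inv\<^bsub>G\<^esub> u \<otimes>\<^bsub>G\<^esub> v = \<one>\<^bsub>G\<^esub>"
      using that uv by (metis G.inv_closed G.inv_equality G.inv_inv)
    ultimately show ?thesis
      by (auto simp: less_def)
  qed
  have left: "less (g \<otimes>\<^bsub>G\<^esub> u) (g \<otimes>\<^bsub>G\<^esub> v) \<longleftrightarrow> less u v"
    if "g \<in> carrier G" "u \<in> carrier G" "v \<in> carrier G" for g u v
  proof -
    have "inv\<^bsub>G\<^esub> g \<otimes>\<^bsub>G\<^esub> (g \<otimes>\<^bsub>G\<^esub> v) = v"
      using that by (simp add: G.m_assoc[symmetric])
    then have "inv\<^bsub>G\<^esub> (g \<otimes>\<^bsub>G\<^esub> u) \<otimes>\<^bsub>G\<^esub> (g \<otimes>\<^bsub>G\<^esub> v) = inv\<^bsub>G\<^esub> u \<otimes>\<^bsub>G\<^esub> v"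
      using that by (simp add: G.inv_mult_group G.m_assoc)
    then show ?thesis
      using that by (simp add: less_def)
  qed
  have "\<exists>m\<in>S. \<forall>x\<in>S. \<not> less m x"
  proof (rule finite_maximal_element)
    show "finite S" "S \<noteq> {}"
      using supp C A by (auto simp: S)
  qed (use irrefl trans SG in blast)+
  then obtain m where m: "m \<in> S" and max: "\<And>x. x \<in> S \<Longrightarrow> \<not> less m x"
    by blast
  from m obtain y z where yz: "y \<in> support K c" "z \<in> support K a" "m = y \<otimes>\<^bsub>G\<^esub> z"
    by (auto simp: S)
  have in_S: "v \<otimes>\<^bsub>G\<^esub> w \<in> S" if "v \<in> support K c" "w \<in> support K a" for v w
    using that by (force simp: S)
  \<comment> \<open>Suppose that \<open>m\<close> is both y z and v w. Then z < w would make y w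
    larger than \<open>m\<close>, and w < z would make v z larger than \<open>m\<close>.\<close>
  have unique: "v = y" if v: "v \<in> support K c" and w: "inv\<^bsub>G\<^esub> v \<otimes>\<^bsub>G\<^esub> m \<in> support K a" for v
  proof -
    define w where "w = inv\<^bsub>G\<^esub> v \<otimes>\<^bsub>G\<^esub> m"
    have car: "v \<in> carrier G" "w \<in> carrier G" "y \<in> carrier G" "z \<in> carrier G" "m \<in> carrier G"
      using supp v w yz m SG by (auto simp: w_def)
    have vw: "m = v \<otimes>\<^bsub>G\<^esub> w"
      using car(1,5) by (simp add: w_def G.m_assoc[symmetric])
    have "\<not> less z w"
      using max[OF in_S[OF yz(1) w]] left[of y z w] car by (simp add: yz(3) w_def)
    moreover have "\<not> less w z"
      using max[OF in_S[OF v yz(2)]] left[of v w z] car by (simp add: vw)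
    \<comment> \<open>The elements \<open>z\<close> and \<open>w\<close> need not lie in
      \<open>S\<close>; they are compared through v z and v w, which do.\<close>
    moreover have "z = w \<or> less z w \<or> less w z"
      using total[OF in_S[OF v yz(2)] in_S[OF v w]] left car by (auto simp: w_def)
    ultimately have "z = w" by blast
    then show "v = y"
      using vw yz(3) car by simp
  qed
  have "(c \<otimes>\<^bsub>group_ring K G\<^esub> a) m =
      (\<Oplus>\<^bsub>K\<^esub>v\<in>support K c. c v \<otimes>\<^bsub>K\<^esub> a (inv\<^bsub>G\<^esub> v \<otimes>\<^bsub>G\<^esub> m))"
    using m SG by (intro group_ring_mult_superset K.ring_axioms G c a supp) auto
  \<comment> \<open>By \<open>unique\<close>, every term except the one at \<open>y\<close>
    vanishes.\<close>
  also have "\<dots> = (\<Oplus>\<^bsub>K\<^esub>v\<in>support K c. if y = v then c v \<otimes>\<^bsub>K\<^esub> a z else \<zero>\<^bsub>K\<^esub>)"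
  proof (rule K.finsum_cong')
    fix v assume v: "v \<in> support K c"
    have "inv\<^bsub>G\<^esub> y \<otimes>\<^bsub>G\<^esub> m = z"
      using yz supp by (auto simp: G.m_assoc[symmetric] subset_iff)
    then show "c v \<otimes>\<^bsub>K\<^esub> a (inv\<^bsub>G\<^esub> v \<otimes>\<^bsub>G\<^esub> m) = (if y = v then c v \<otimes>\<^bsub>K\<^esub> a z else \<zero>\<^bsub>K\<^esub>)"
      using unique[OF v] vals by (cases "inv\<^bsub>G\<^esub> v \<otimes>\<^bsub>G\<^esub> m \<in> support K a") (auto simp: support_def)
  qed (use vals in auto)
  also have "\<dots> = c y \<otimes>\<^bsub>K\<^esub> a z"
    using vals supp yz by (intro K.finsum_singleton) auto
  also have "\<dots> \<noteq> \<zero>\<^bsub>K\<^esub>"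
    using yz vals by (simp add: support_def K.integral_iff)
  finally have "(c \<otimes>\<^bsub>group_ring K G\<^esub> a) m \<noteq> \<zero>\<^bsub>K\<^esub>" .
  moreover have "x = m \<or> inv\<^bsub>G\<^esub> x \<otimes>\<^bsub>G\<^esub> m \<in> P" if "x \<in> S" for x
    using total[OF that m] max[OF that] by (auto simp: less_def)
  ultimately show ?thesis
    using m by blast
qed

text \<open>Both the maximum and the minimum of the product of the supports survive in \<open>c a\<close>, so they
  coincide when \<open>c a = 1\<close>.\<close>

lemma left_invertible_support:
  fixes K (structure) and G (structure)
  assumes K: "field K" and G: "group G" and ord: "locally_left_orderable G"
    and c: "c \<in> carrier (group_ring K G)" and a: "a \<in> carrier (group_ring K G)"
    and inv: "c \<otimes>\<^bsub>group_ring K G\<^esub> a = \<one>\<^bsub>group_ring K G\<^esub>"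
    and xy: "x \<in> support K a" "y \<in> support K a"
  shows "x = y"
proof -
  interpret K: field K by fact
  interpret G: group G by fact
  define S where "S = (\<lambda>(y, z). y \<otimes>\<^bsub>G\<^esub> z) ` (support K c \<times> support K a)"
  define D where "D = (\<lambda>(u, v). inv\<^bsub>G\<^esub> u \<otimes>\<^bsub>G\<^esub> v) ` (S \<times> S)"
  have supp: "finite (support K c)" "finite (support K a)"
      "support K c \<subseteq> carrier G" "support K a \<subseteq> carrier G"
    using c a by (auto simp: group_ring_def)
  have SG: "S \<subseteq> carrier G"
    unfolding S_def using supp by auto
  have D: "D \<subseteq> carrier G" "finite D"
    using SG supp by (auto simp: D_def S_def)
  then obtain P where P: "positive_cone G D P"
    using ord by (auto simp: locally_left_orderable_def)
  have one: "\<one>\<^bsub>group_ring K G\<^esub> g = (if g = \<one>\<^bsub>G\<^esub> then \<one>\<^bsub>K\<^esub> else \<zero>\<^bsub>K\<^esub>)" for g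
    by (simp add: group_ring_def)
  have C: "support K c \<noteq> {}"
  proof
    assume "support K c = {}"
    then have "(c \<otimes>\<^bsub>group_ring K G\<^esub> a) \<one>\<^bsub>G\<^esub> = \<zero>\<^bsub>K\<^esub>"
      by (simp add: group_ring_def)
    then show False
      by (simp add: inv one)
  qed
  have A: "support K a \<noteq> {}"
    using xy by blast
  have max: "x = \<one>\<^bsub>G\<^esub> \<or> inv\<^bsub>G\<^esub> x \<in> Q" if Q: "positive_cone G D Q" and x: "x \<in> S" for Q x
  proof -
    obtain m where m: "m \<in> S" "\<forall>x\<in>S. x = m \<or> inv\<^bsub>G\<^esub> x \<otimes>\<^bsub>G\<^esub> m \<in> Q"
        "(c \<otimes>\<^bsub>group_ring K G\<^esub> a) m \<noteq> \<zero>\<^bsub>K\<^esub>"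
      using product_support_maximum[OF K G c a C A S_def] Q unfolding D_def by blast
    \<comment> \<open>The product is the ring identity, which is supported at the group identity
      only.\<close>
    from m(3) have "m = \<one>\<^bsub>G\<^esub>"
      by (auto simp: inv one split: if_splits)
    then show ?thesis
      using m(2) x SG by (auto simp: subset_iff)
  qed
  \<comment> \<open>Using \<open>max\<close> for \<open>P\<close> and for its set of inverses bounds
    \<open>s\<close> from both sides: otherwise \<open>s\<close> and its inverse would both lie in
    \<open>P\<close>.\<close>
  have S_one: "s = \<one>\<^bsub>G\<^esub>" if s: "s \<in> S" for s
  proof (rule ccontr)
    assume "s \<noteq> \<one>\<^bsub>G\<^esub>"
    then have "inv\<^bsub>G\<^esub> s \<in> P" "inv\<^bsub>G\<^esub> s \<in> m_inv G ` P"
      using max[OF P s] max[OF G.positive_cone_inverse[OF P D(1)] s] by auto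
    then have "inv\<^bsub>G\<^esub> s \<in> P" "s \<in> P"
      using P s SG by (auto simp: positive_cone_def subset_iff)
    then have "s \<otimes>\<^bsub>G\<^esub> inv\<^bsub>G\<^esub> s \<in> P"
      using P by (auto simp: positive_cone_def)
    then show False
      using P s SG by (auto simp: positive_cone_def)
  qed
  obtain u where u: "u \<in> support K c"
    using C by blast
  have "u \<otimes>\<^bsub>G\<^esub> x = u \<otimes>\<^bsub>G\<^esub> y"
    using u xy S_one[of "u \<otimes>\<^bsub>G\<^esub> x"] S_one[of "u \<otimes>\<^bsub>G\<^esub> y"] by (force simp: S_def)
  moreover have "u \<in> carrier G" "x \<in> carrier G" "y \<in> carrier G"
    using u xy supp by auto
  ultimately show "x = y"
    by simp
qed

theorem semiprimitive_group_ring: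
  fixes K (structure) and G (structure)
  assumes K: "field K" and G: "group G" and ord: "locally_left_orderable G"
    and inf: "infinite (carrier G)"
  shows "semiprimitive (group_ring K G)"
proof -
  interpret K: field K by fact
  interpret G: group G by fact
  let ?R = "group_ring K G"
  interpret R: ring ?R
    by (intro ring_group_ring K.ring_axioms G)
  have zero: "\<zero>\<^bsub>?R\<^esub> = (\<lambda>_. \<zero>\<^bsub>K\<^esub>)" and one: "\<one>\<^bsub>?R\<^esub> = (\<lambda>g. if g = \<one>\<^bsub>G\<^esub> then \<one>\<^bsub>K\<^esub> else \<zero>\<^bsub>K\<^esub>)"
    and add: "(a \<oplus>\<^bsub>?R\<^esub> b) g = a g \<oplus>\<^bsub>K\<^esub> b g" for a b g
    by (simp_all add: group_ring_def)
  have "x = \<zero>\<^bsub>?R\<^esub>" if x: "x \<in> jacobson_radical ?R" for x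
  proof (rule ccontr)
    assume "x \<noteq> \<zero>\<^bsub>?R\<^esub>"
    then obtain h where h: "h \<in> support K x"
      by (auto simp: zero support_def)
    have xR: "x \<in> carrier ?R"
      using x by (simp add: jacobson_radical_def)
    then have supp: "finite (support K x)" "support K x \<subseteq> carrier G" and vals: "x g \<in> carrier K" for g
      by (auto simp: group_ring_def)
    \<comment> \<open>The coefficient of g x at the identity is the value of \<open>x\<close> at
      g^-1. This choice makes it vanish, and it is possible because the support of \<open>x\<close>
      is finite.\<close>
    obtain g where g: "g \<in> carrier G" "g \<notin> m_inv G ` support K x"
    proof -
      have "\<not> carrier G \<subseteq> m_inv G ` support K x"
        using inf finite_subset[OF _ finite_imageI[OF supp(1)]] by metis
      then show ?thesis
        using that by auto
    qed
    \<comment> \<open>The group element \<open>g\<close> as an element of the group ring;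
      multiplication by it translates \<open>x\<close>.\<close>
    define r where "r = (\<lambda>u. if u = g then \<one>\<^bsub>K\<^esub> else \<zero>\<^bsub>K\<^esub>)"
    have r: "r \<in> carrier ?R" and r_supp: "support K r = {g}"
      using g by (auto simp: group_ring_def r_def support_def)
    have rx: "(r \<otimes>\<^bsub>?R\<^esub> x) u = x (inv\<^bsub>G\<^esub> g \<otimes>\<^bsub>G\<^esub> u)" if "u \<in> carrier G" for u
      using that vals by (simp add: group_ring_def r_supp) (simp add: r_def)
    let ?a = "\<one>\<^bsub>?R\<^esub> \<ominus>\<^bsub>?R\<^esub> r \<otimes>\<^bsub>?R\<^esub> x"
    have a: "?a \<in> carrier ?R"
      using r xR by simp
    have rx_closed: "r \<otimes>\<^bsub>?R\<^esub> x \<in> carrier ?R"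
      using r xR by simp
    \<comment> \<open>Written as a sum, the relation can be evaluated pointwise without a formula
      for negatives.\<close>
    have sum: "?a \<oplus>\<^bsub>?R\<^esub> r \<otimes>\<^bsub>?R\<^esub> x = \<one>\<^bsub>?R\<^esub>"
      using rx_closed by (simp add: R.minus_eq R.a_assoc R.l_neg)
    have eq: "?a u \<oplus>\<^bsub>K\<^esub> x (inv\<^bsub>G\<^esub> g \<otimes>\<^bsub>G\<^esub> u) = (if u = \<one>\<^bsub>G\<^esub> then \<one>\<^bsub>K\<^esub> else \<zero>\<^bsub>K\<^esub>)"
      if "u \<in> carrier G" for u
      using fun_cong[OF sum, of u] rx[OF that] by (simp only: add one)
    have a_vals: "?a u \<in> carrier K" for u
      using a by (auto simp: group_ring_def)
    have not_inv: "inv\<^bsub>G\<^esub> g \<notin> support K x"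
    proof
      assume "inv\<^bsub>G\<^esub> g \<in> support K x"
      then have "inv\<^bsub>G\<^esub> (inv\<^bsub>G\<^esub> g) \<in> m_inv G ` support K x"
        by blast
      then show False
        using g by simp
    qed
    have one_supp: "\<one>\<^bsub>G\<^esub> \<in> support K ?a"
      using eq[of "\<one>\<^bsub>G\<^esub>"] not_inv g a_vals by (auto simp: support_def)
    have gh: "g \<otimes>\<^bsub>G\<^esub> h \<noteq> \<one>\<^bsub>G\<^esub>"
    proof
      assume "g \<otimes>\<^bsub>G\<^esub> h = \<one>\<^bsub>G\<^esub>"
      then have "g = inv\<^bsub>G\<^esub> h"
        using G.inv_equality[of g h] g(1) h supp by auto
      then show False
        using g(2) h by blast
    qed
    have gh_supp: "g \<otimes>\<^bsub>G\<^esub> h \<in> support K ?a"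
    proof -
      have "inv\<^bsub>G\<^esub> g \<otimes>\<^bsub>G\<^esub> (g \<otimes>\<^bsub>G\<^esub> h) = h" "g \<otimes>\<^bsub>G\<^esub> h \<in> carrier G"
        using g h supp by (auto simp: G.m_assoc[symmetric] subset_iff)
      then have "?a (g \<otimes>\<^bsub>G\<^esub> h) \<oplus>\<^bsub>K\<^esub> x h = \<zero>\<^bsub>K\<^esub>"
        using eq[of "g \<otimes>\<^bsub>G\<^esub> h"] gh by simp
      then show ?thesis
        using h vals by (auto simp: support_def)
    qed
    obtain c where c: "c \<in> carrier ?R" "c \<otimes>\<^bsub>?R\<^esub> ?a = \<one>\<^bsub>?R\<^esub>"
      using R.jacobson_radical_left_invertible[OF x r] by blast
    have "g \<otimes>\<^bsub>G\<^esub> h = \<one>\<^bsub>G\<^esub>"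
      using left_invertible_support[OF K G ord c(1) a c(2) gh_supp one_supp] .
    with gh show False ..
  qed
  moreover have "\<zero>\<^bsub>?R\<^esub> \<in> jacobson_radical ?R"
    by (simp add: jacobson_radical_def maximal_left_ideal_def left_ideal_def
        additive_subgroup.zero_closed)
  ultimately show ?thesis
    unfolding semiprimitive_def by blast
qed

section \<open>Free groups are left-orderable\<close>

definition inv_letter :: "'g \<times> bool \<Rightarrow> 'g \<times> bool"
  where "inv_letter = (\<lambda>(s, b). (s, \<not> b))"

definition inv_word :: "'g word \<Rightarrow> 'g word"
  where "inv_word w = rev (map inv_letter w)"

definition reduced :: "'g word \<Rightarrow> bool"
  where "reduced = successively (\<lambda>x y. y \<noteq> inv_letter x)"

lemma inv_letter_simps [simp]:
  "inv_letter (inv_letter x) = x" "fst (inv_letter x) = fst x" "snd (inv_letter x) \<longleftrightarrow> \<not> snd x"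
  "inv_letter (s, b) = (s, \<not> b)"
  by (auto simp: inv_letter_def split: prod.splits)

lemma inv_word_simps [simp]:
  "inv_word [] = []" "inv_word (x # w) = inv_word w @ [inv_letter x]"
  "inv_word (v @ w) = inv_word w @ inv_word v" "inv_word (inv_word w) = w"
  "inv_word w = [] \<longleftrightarrow> w = []"
  by (simp_all add: inv_word_def rev_map o_def)

lemma words_inv_word [simp]: "inv_word w \<in> words S \<longleftrightarrow> w \<in> words S"
  by (induction w) auto

lemma last_inv_word: "w \<noteq> [] \<Longrightarrow> last (inv_word w) = inv_letter (hd w)"
  by (cases w) auto

lemma reduced_simps [simp]:
  "reduced []" "reduced [x]" "reduced (x # y # w) \<longleftrightarrow> y \<noteq> inv_letter x \<and> reduced (y # w)"
  by (simp_all add: reduced_def)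

lemma reduced_append:
  "reduced (u @ v) \<longleftrightarrow> reduced u \<and> reduced v \<and>
    (u = [] \<or> v = [] \<or> hd v \<noteq> inv_letter (last u))"
  by (auto simp: reduced_def successively_append_iff)

lemma reduced_Cons: "reduced (x # w) \<longleftrightarrow> reduced w \<and> (w = [] \<or> hd w \<noteq> inv_letter x)"
  by (cases w) auto

lemma reduced_inv_word [simp]: "reduced (inv_word w) \<longleftrightarrow> reduced w"
proof -
  have "reduced (inv_word w)" if "reduced w" for w :: "'g word"
    using that
  proof (induction w)
    case (Cons x w)
    then show ?case
      by (cases "w = []") (auto simp: reduced_append reduced_Cons last_inv_word)
  qed simp
  from this[of w] this[of "inv_word w"] show ?thesis by auto
qed

text \<open>Here \<open>p\<close> is the full cancellation between the two words, peeled off letter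
  by letter from the end of \<open>u\<close>.\<close>

lemma reduced_append_decomposition:
  "reduced u \<Longrightarrow> reduced v \<Longrightarrow> \<exists>u' p v'. u = u' @ p \<and> v = inv_word p @ v' \<and> reduced (u' @ v')"
proof (induction u arbitrary: v rule: rev_induct)
  case Nil
  then show ?case by auto
next
  case (snoc x u)
  show ?case
  proof (cases "v \<noteq> [] \<and> hd v = inv_letter x")
    case True
    then obtain v1 where v: "v = inv_letter x # v1"
      by (cases v) auto
    obtain u' p v' where "u = u' @ p" "v1 = inv_word p @ v'" "reduced (u' @ v')"
      using snoc.IH[of v1] snoc.prems v by (auto simp: reduced_append reduced_Cons)
    then have "u @ [x] = u' @ (p @ [x])" "v = inv_word (p @ [x]) @ v'" "reduced (u' @ v')"
      using v by auto
    then show ?thesis by blast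
  next
    case False
    then have "reduced ((u @ [x]) @ v)"
      using snoc.prems by (auto simp: reduced_append reduced_Cons)
    then show ?thesis by (metis append_Nil append_Nil2 inv_word_simps(1))
  qed
qed

section \<open>Existence and uniqueness of reduced representatives\<close>

lemma pres_cong_inv_word:
  assumes "w \<in> words S"
  shows "pres_cong S R (inv_word w @ w) []" "pres_cong S R (w @ inv_word w) []"
proof -
  have inverse: "pres_cong S R (inv_word v @ v) []" if "v \<in> words S" for v
    using pres_cong_inverse[OF that] by (simp add: inv_word_def inv_letter_def)
  from inverse[of w] inverse[of "inv_word w"] assms
  show "pres_cong S R (inv_word w @ w) []" "pres_cong S R (w @ inv_word w) []"
    by simp_all
qed

text \<open>Left multiplication by a letter as an operation on reduced words, as in van der
  Waerden's proof that reduced forms are unique.\<close>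

definition cancel_cons :: "'g \<times> bool \<Rightarrow> 'g word \<Rightarrow> 'g word"
  where "cancel_cons x w = (if w \<noteq> [] \<and> hd w = inv_letter x then tl w else x # w)"

lemma reduced_cancel_cons: "reduced w \<Longrightarrow> reduced (cancel_cons x w)"
  by (cases w) (auto simp: cancel_cons_def reduced_Cons)

lemma cancel_cons_cancel: "reduced w \<Longrightarrow> cancel_cons x (cancel_cons (inv_letter x) w) = w"
  by (cases w) (auto simp: cancel_cons_def reduced_Cons)

lemma foldr_cancel_cons_reduced: "reduced w \<Longrightarrow> foldr cancel_cons w [] = w"
  by (induction w) (auto simp: cancel_cons_def reduced_Cons)

lemma reduced_foldr_cancel_cons: "reduced w \<Longrightarrow> reduced (foldr cancel_cons v w)"
  by (induction v) (auto simp: reduced_cancel_cons)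

text \<open>With no relations, only cancellation has to be checked: on reduced words a letter and
  its inverse act as mutually inverse maps.\<close>

lemma pres_cong_foldr_cancel_cons:
  "pres_cong S {} v w \<Longrightarrow> reduced u \<Longrightarrow> foldr cancel_cons v u = foldr cancel_cons w u"
proof (induction rule: pres_cong.induct)
  case (pres_cancel v w s b)
  then show ?case
    using cancel_cons_cancel[of _ "(s, b)"] by (simp add: reduced_foldr_cancel_cons)
qed simp_all

text \<open>Acting on the empty word gives back a reduced word, and congruent words act
  alike.\<close>

lemma pres_cong_reduced_eq:
  assumes "pres_cong S {} v w" "reduced v" "reduced w"
  shows "v = w"
  using pres_cong_foldr_cancel_cons[OF assms(1), of "[]"] assms
  by (simp add: foldr_cancel_cons_reduced)

lemma pres_cong_reduced_exists:
  assumes "w \<in> words S"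
  shows "\<exists>v\<in>words S. reduced v \<and> pres_cong S R w v"
  using assms
proof (induction w)
  case Nil
  show ?case by (intro bexI[of _ "[]"]) (simp_all add: pres_refl)
next
  case (Cons x w)
  then obtain v where v: "v \<in> words S" "reduced v" "pres_cong S R w v" by auto
  obtain s b where x: "x = (s, b)" by force
  have xw: "pres_cong S R (x # w) (x # v)"
    using pres_cong_context[OF v(3), of "[x]" "[]"] Cons.prems by simp
  show ?case
  proof (cases "v \<noteq> [] \<and> hd v = inv_letter x")
    case True
    then obtain v' where v': "v = inv_letter x # v'"
      by (cases v) auto
    have "pres_cong S R (x # v) v'"
      using pres_cancel[of "[]" S v' s R b] v Cons.prems by (simp add: x v')
    then show ?thesis
      using xw v v' by (metis pres_trans reduced_Cons words_Cons)
  next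
    case False
    then show ?thesis
      using xw v Cons.prems by (intro bexI[of _ "x # v"]) (auto simp: reduced_Cons)
  qed
qed

text \<open>The sign of the turn, at a vertex of the Cayley tree, from the outgoing edge \<open>a\<close> to the
  outgoing edge \<open>b\<close>.\<close>

definition turn :: "'a rel \<Rightarrow> 'a \<Rightarrow> 'a \<Rightarrow> int"
  where "turn r a b = (if a = b then 0 else if (a, b) \<in> r then 1 else -1)"

text \<open>The weight of the path in the Cayley tree that is labelled by a reduced word: the signs of its
  edges plus those of its turns.\<close>

fun path_weight :: "('g \<times> bool) rel \<Rightarrow> 'g word \<Rightarrow> int" where
  "path_weight r [] = 0"
| "path_weight r [x] = (if snd x then 1 else -1)"
| "path_weight r (x # y # w) =
    (if snd x then 1 else -1) + turn r (inv_letter x) y + path_weight r (y # w)"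

text \<open>The turn at the vertex where the path of \<open>v\<close> continues that of
  \<open>u\<close>. Seen from there, the last edge of \<open>u\<close> is the outgoing edge
  \<open>inv_letter (last u)\<close>. An empty path causes no turn.\<close>

definition junction :: "('g \<times> bool) rel \<Rightarrow> 'g word \<Rightarrow> 'g word \<Rightarrow> int"
  where "junction r u v = (if u = [] \<or> v = [] then 0 else turn r (inv_letter (last u)) (hd v))"

section \<open>Path weights of products and inverses\<close>

lemma turn_commute: "linear_order r \<Longrightarrow> turn r b a = - turn r a b"
  by (auto simp: turn_def linear_order_on_def partial_order_on_def total_on_def dest: antisymD)

text \<open>For distinct edges the expression equals the sum of \<open>turn r a c\<close>,
  \<open>turn r c b\<close> and \<open>turn r b a\<close>; three equal signs would form a cycle in
  the order. If two edges coincide, it vanishes.\<close>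

lemma turn_triangle: "linear_order r \<Longrightarrow> \<bar>turn r a c - turn r a b - turn r b c\<bar> \<le> 1"
  unfolding turn_def linear_order_on_def partial_order_on_def preorder_on_def total_on_def
  by (smt (verit, best) UNIV_I antisymD transD)

text \<open>Three paths meet at one vertex, with outgoing edges \<open>inv_letter (last u)\<close>,
  \<open>hd p\<close> and \<open>hd v\<close>, so the bound for turns applies. If one of the words
  is empty, at most one term survives.\<close>

lemma junction_triangle:
  assumes "linear_order r"
  shows "\<bar>junction r u v - junction r u p - junction r (inv_word p) v\<bar> \<le> 1"
proof -
  have bound: "\<bar>turn r a b\<bar> \<le> 1" for a b
    by (simp add: turn_def)
  show ?thesis
    using turn_triangle[OF assms] bound by (auto simp: junction_def last_inv_word)
qed

lemma path_weight_append:
  "path_weight r (u @ v) = path_weight r u + junction r u v + path_weight r v"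
proof (induction u rule: induct_list012)
  case (2 x)
  then show ?case by (cases v) (auto simp: junction_def)
qed (auto simp: junction_def)

text \<open>Reversing a path flips the sign of each edge and exchanges the two edges of each
  turn.\<close>

lemma path_weight_inv_word:
  assumes "linear_order r"
  shows "path_weight r (inv_word w) = - path_weight r w"
proof (induction w)
  case (Cons x w)
  have "path_weight r (x # w) = path_weight r [x] + junction r [x] w + path_weight r w"
    using path_weight_append[of r "[x]" w] by simp
  then show ?case
    using Cons turn_commute[OF assms, of "inv_letter x" "hd w"]
    by (auto simp: path_weight_append junction_def last_inv_word)
qed simp

text \<open>A word of n > 0 letters has n edges and n - 1 turns. Being reduced, it has no turn of
  sign 0, so the weight is a sum of 2n - 1 signs.\<close>

lemma odd_path_weight: "reduced w \<Longrightarrow> w \<noteq> [] \<Longrightarrow> odd (path_weight r w)"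
  by (induction r w rule: path_weight.induct) (auto simp: turn_def)

text \<open>The contributions of \<open>p\<close> and \<open>inv_word p\<close> cancel, so the two
  given weights add up to that of \<open>u @ v\<close> with an error of at most 1. Positive integers
  have sum at least 2, which leaves at least 1.\<close>

lemma path_weight_append_pos:
  assumes "linear_order r" "path_weight r (u @ p) > 0" "path_weight r (inv_word p @ v) > 0"
  shows "path_weight r (u @ v) > 0"
  using assms junction_triangle[OF assms(1), of u v p]
  by (simp add: path_weight_append path_weight_inv_word)

text \<open>The elements whose reduced word has positive weight form a cone.\<close>

theorem left_orderable_free_group: "left_orderable (presented_group X {})"
proof -
  let ?G = "presented_group X {}" and ?c = "\<lambda>w. pres_rel X {} `` {w}"
  interpret group ?G
    by (rule group_presented_group)
  \<comment> \<open>Turns need a linear order on the letters; the well-ordering theorem provides one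
    in any cardinality.\<close>
  obtain r :: "('a \<times> bool) rel" where "well_order r"
    using well_ordering by metis
  then have r: "linear_order r"
    by (simp add: well_order_on_def)
  have car: "carrier ?G = ?c ` words X"
    by (auto simp: presented_group_def quotient_def)
  have one: "\<one>\<^bsub>?G\<^esub> = ?c []"
    by (simp add: presented_group_def)
  have eq: "?c v = ?c w \<longleftrightarrow> pres_cong X {} v w" if "v \<in> words X" "w \<in> words X" for v w
    using eq_equiv_class_iff[OF equiv_pres_rel that] by (simp add: pres_rel_def)
  define P where "P = {?c w | w. w \<in> words X \<and> reduced w \<and> path_weight r w > 0}"
  have "positive_cone ?G (carrier ?G) P"
    unfolding positive_cone_def
  proof (intro conjI ballI)
    show "P \<subseteq> carrier ?G"
      by (auto simp: P_def car)
    show "x \<otimes>\<^bsub>?G\<^esub> y \<in> P" if "x \<in> P" "y \<in> P" for x y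
    proof -
      from that obtain u v where u: "u \<in> words X" "reduced u" "path_weight r u > 0" "x = ?c u"
        and v: "v \<in> words X" "reduced v" "path_weight r v > 0" "y = ?c v"
        by (auto simp: P_def)
      \<comment> \<open>Cancelling \<open>p\<close> gives the reduced word of the product, to which
        the weight estimate applies.\<close>
      obtain u' p v' where d: "u = u' @ p" "v = inv_word p @ v'" "reduced (u' @ v')"
        using reduced_append_decomposition[OF u(2) v(2)] by blast
      have "pres_cong X {} (u @ v) (u' @ v')"
        using pres_cong_context[OF pres_cong_inv_word(2)[of p X "{}"], of u' v'] d u(1) v(1) by simp
      then have "x \<otimes>\<^bsub>?G\<^esub> y = ?c (u' @ v')"
        using u v d by (simp add: presented_group_mult eq)
      moreover have "path_weight r (u' @ v') > 0"
        using path_weight_append_pos[OF r] u(3) v(3) d by simp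
      ultimately show ?thesis
        using u(1) v(1) d by (auto simp: P_def)
    qed
    show "\<one>\<^bsub>?G\<^esub> \<notin> P"
      using pres_cong_reduced_eq by (fastforce simp: P_def one eq)
    show "x = \<one>\<^bsub>?G\<^esub> \<or> x \<in> P \<or> inv\<^bsub>?G\<^esub> x \<in> P" if x: "x \<in> carrier ?G" for x
    proof -
      obtain w where w: "w \<in> words X" "reduced w" "x = ?c w"
        using x pres_cong_reduced_exists[of _ X "{}"] eq unfolding car by blast
      have "?c (inv_word w) \<otimes>\<^bsub>?G\<^esub> x = \<one>\<^bsub>?G\<^esub>"
        using w pres_cong_inv_word(1)[OF w(1), of "{}"] by (simp add: presented_group_mult one eq)
      moreover have "?c (inv_word w) \<in> carrier ?G"
        using w by (auto simp: car)
      ultimately have inv: "inv\<^bsub>?G\<^esub> x = ?c (inv_word w)"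
        using x inv_equality by metis
      \<comment> \<open>The weight of a nonempty reduced word is odd, hence nonzero, and the inverse
        word has the opposite weight.\<close>
      consider "w = []" | "path_weight r w > 0" | "path_weight r (inv_word w) > 0"
        using odd_path_weight[OF w(2), of r] path_weight_inv_word[OF r, of w]
        by (cases "path_weight r w" "0 :: int" rule: linorder_cases) auto
      then show ?thesis
      proof cases
        case 3
        then have "inv\<^bsub>?G\<^esub> x \<in> P"
          unfolding inv P_def using w by auto
        then show ?thesis by blast
      qed (use w in \<open>auto simp: P_def one\<close>)
    qed
  qed
  then show ?thesis
    by (auto simp: left_orderable_def)
qed

lemma left_orderable_is_free_group:
  assumes "is_free_group F"
  shows "left_orderable F"
proof -
  obtain X :: "'a set" and e where "e \<in> iso F (presented_group X {})"
    using assms by (auto simp: is_free_group_def is_iso_def)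
  then show ?thesis
    using assms left_orderable_inj_hom[OF _ group_presented_group _ _ left_orderable_free_group]
    by (auto simp: is_free_group_def iso_def bij_betw_def)
qed

section \<open>Presented groups\<close>

lemma presented_group_eqI:
  assumes "pres_cong S R v w"
  shows "pres_rel S R `` {v} = pres_rel S R `` {w}"
  using equiv_class_eq[OF equiv_pres_rel] assms by (simp add: pres_rel_def)

lemma presented_group_closed: "w \<in> words S \<Longrightarrow> pres_rel S R `` {w} \<in> carrier (presented_group S R)"
  by (auto simp: presented_group_def quotient_def)

lemma presented_group_inv_letter:
  assumes "s \<in> S"
  shows "pres_rel S R `` {[(s, False)]} = inv\<^bsub>presented_group S R\<^esub> (pres_rel S R `` {[(s, True)]})"
proof -
  interpret group "presented_group S R"
    by (rule group_presented_group)
  have "pres_rel S R `` {[(s, False)]} \<otimes>\<^bsub>presented_group S R\<^esub> pres_rel S R `` {[(s, True)]} =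
      \<one>\<^bsub>presented_group S R\<^esub>"
    using assms presented_group_eqI[OF pres_cancel[of "[]" S "[]" s R False]]
    by (simp add: presented_group_mult) (simp add: presented_group_def)
  then show ?thesis
    using assms by (intro inv_equality[symmetric] presented_group_closed) auto
qed

section \<open>The universal property of a presentation\<close>

definition word_val :: "('h, 'n) monoid_scheme \<Rightarrow> ('g \<Rightarrow> 'h) \<Rightarrow> 'g word \<Rightarrow> 'h"
  where "word_val H h w =
    foldr (\<lambda>(s, b) z. (if b then h s else inv\<^bsub>H\<^esub> (h s)) \<otimes>\<^bsub>H\<^esub> z) w \<one>\<^bsub>H\<^esub>"

lemma word_val_simps [simp]:
  "word_val H h [] = \<one>\<^bsub>H\<^esub>"
  "word_val H h ((s, b) # w) = (if b then h s else inv\<^bsub>H\<^esub> (h s)) \<otimes>\<^bsub>H\<^esub> word_val H h w"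
  by (simp_all add: word_val_def)

lemma (in group) word_val_closed [simp]:
  assumes "h \<in> S \<rightarrow> carrier G" "w \<in> words S"
  shows "word_val G h w \<in> carrier G"
  using assms(2)
proof (induction w)
  case (Cons x w)
  then show ?case
    using assms(1) by (cases x) (auto simp: Pi_iff)
qed simp

lemma (in group) word_val_append:
  assumes "h \<in> S \<rightarrow> carrier G" "v \<in> words S" "w \<in> words S"
  shows "word_val G h (v @ w) = word_val G h v \<otimes> word_val G h w"
  using assms(2)
proof (induction v)
  case (Cons x v)
  then show ?case
    using assms by (cases x) (auto simp: Pi_iff m_assoc word_val_closed[OF assms(1)])
qed (use assms in \<open>simp add: word_val_closed[OF assms(1)]\<close>)

lemma (in group) word_val_pres_cong:
  assumes h: "h \<in> S \<rightarrow> carrier G"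
    and R: "\<And>l r. (l, r) \<in> R \<Longrightarrow> word_val G h l = word_val G h r"
    and "pres_cong S R v w"
  shows "word_val G h v = word_val G h w"
  using assms(3)
proof (induction rule: pres_cong.induct)
  case (pres_cancel v w s b)
  have "h s \<in> carrier G" "word_val G h w \<in> carrier G"
    using h pres_cancel word_val_closed[OF h] by auto
  then have "word_val G h ([(s, b), (s, \<not> b)] @ w) = word_val G h w"
    by (simp add: m_assoc[symmetric])
  then show ?case
    using pres_cancel word_val_append[OF h, of v "[(s, b), (s, \<not> b)] @ w"] word_val_append[OF h, of v w]
    by simp
next
  case (pres_relation v w l r)
  then show ?case
    using R[of l r] by (simp add: word_val_append[OF h])
qed simp_all

text \<open>Von Dyck's theorem: if the relations hold in \<open>H\<close>, then
  \<open>word_val\<close> is constant on congruence classes.\<close>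

lemma presented_group_hom:
  assumes "group H" and h: "h \<in> S \<rightarrow> carrier H"
    and R: "\<And>l r. (l, r) \<in> R \<Longrightarrow> word_val H h l = word_val H h r"
  obtains e where "e \<in> hom (presented_group S R) H"
    and "\<And>w. w \<in> words S \<Longrightarrow> e (pres_rel S R `` {w}) = word_val H h w"
proof
  interpret H: group H by fact
  let ?c = "\<lambda>w. pres_rel S R `` {w}"
  define e where "e A = word_val H h (SOME w. w \<in> A)" for A
  show e: "e (?c w) = word_val H h w" if "w \<in> words S" for w
  proof -
    have "(SOME v. v \<in> ?c w) \<in> ?c w"
      by (rule someI[of _ w]) (use that in \<open>simp add: pres_rel_def pres_refl\<close>)
    then have "pres_cong S R w (SOME v. v \<in> ?c w)"
      by (simp add: pres_rel_def)
    then show ?thesis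
      using H.word_val_pres_cong[OF h R] by (simp add: e_def)
  qed
  have car: "carrier (presented_group S R) = ?c ` words S"
    by (auto simp: presented_group_def quotient_def)
  show "e \<in> hom (presented_group S R) H"
    by (rule homI) (auto simp: car e presented_group_mult H.word_val_append[OF h] H.word_val_closed[OF h])
qed

section \<open>Ascending HNN extensions\<close>

text \<open>The regular action of \<open>F\<close> pulled back along \<open>\<phi>\<close> is a disjoint union of copies of the regular
  action, one for each coset of \<open>\<phi> F\<close>.  Hence the union of the copies indexed by the
  sequences of coset representatives is isomorphic to its own pullback: shifting the
  sequence absorbs the coset.\<close>

lemma (in group) injective_endomorphism_conjugation:
  assumes hom: "\<phi> \<in> hom G G" and inj: "inj_on \<phi> (carrier G)"
  obtains \<Omega> :: "('a \<times> (nat \<Rightarrow> 'a)) set" and act T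
  where "act \<in> hom G (BijGroup \<Omega>)" and "inj_on act (carrier G)" and "T \<in> carrier (BijGroup \<Omega>)"
    and "\<And>f. f \<in> carrier G \<Longrightarrow>
      act f \<otimes>\<^bsub>BijGroup \<Omega>\<^esub> T = T \<otimes>\<^bsub>BijGroup \<Omega>\<^esub> act (\<phi> f)"
proof
  interpret \<phi>: group_hom G G \<phi>
    using hom by unfold_locales
  let ?I = "\<phi> ` carrier G"
  have I: "subgroup ?I G"
    by (rule \<phi>.img_is_subgroup)
  \<comment> \<open>\<open>rep y\<close> represents the right coset of \<phi>(F) that contains
    \<open>y\<close>, and \<open>part y\<close> is the element of F for which y is \<phi>(part y)
    times \<open>rep y\<close>.\<close>
  define rep where "rep y = (SOME z. z \<in> ?I #> y)" for y
  define part where "part y = inv_into (carrier G) \<phi> (y \<otimes> inv (rep y))" for y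
  have rep_in: "rep y \<in> ?I #> y" if "y \<in> carrier G" for y
    unfolding rep_def by (rule someI, rule rcos_self[OF that I])
  have rep_closed: "rep y \<in> carrier G" if "y \<in> carrier G" for y
    using rep_in[OF that] that by (auto simp: r_coset_def)
  have rep_mult: "rep (\<phi> f \<otimes> y) = rep y" if "f \<in> carrier G" "y \<in> carrier G" for f y
  proof -
    have "\<phi> f \<otimes> y \<in> ?I #> y"
      using that by (auto simp: r_coset_def)
    then show ?thesis
      unfolding rep_def using repr_independence[OF _ that(2) I] by simp
  qed
  have rep_rep: "rep (rep y) = rep y" if "y \<in> carrier G" for y
    using rep_in[OF that] rep_mult that by (auto simp: r_coset_def)
  have part: "part y \<in> carrier G" "\<phi> (part y) \<otimes> rep y = y" if y: "y \<in> carrier G" for y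
  proof -
    obtain f where f: "f \<in> carrier G" "rep y = \<phi> f \<otimes> y"
      using rep_in[OF y] by (auto simp: r_coset_def)
    then have "y \<otimes> inv (rep y) = \<phi> (inv f)"
      using y by (simp add: inv_mult_group m_assoc[symmetric])
    then have "y \<otimes> inv (rep y) \<in> ?I"
      using f(1) by (metis imageI inv_closed)
    then have "part y \<in> carrier G" "\<phi> (part y) = y \<otimes> inv (rep y)"
      unfolding part_def by (auto intro: inv_into_into f_inv_into_f)
    then show "part y \<in> carrier G" "\<phi> (part y) \<otimes> rep y = y"
      using y rep_closed[OF y] by (auto simp: m_assoc)
  qed
  have part_eq: "part y = f" if "f \<in> carrier G" "y \<in> carrier G" "\<phi> f \<otimes> rep y = y" for f y
  proof -
    have "\<phi> f \<otimes> rep y = \<phi> (part y) \<otimes> rep y"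
      using that part(2) by simp
    then have "\<phi> f = \<phi> (part y)"
      using right_cancel[of "\<phi> f" "rep y" "\<phi> (part y)"] that(1,2) rep_closed[OF that(2)]
        part(1)[OF that(2)] by simp
    then show ?thesis
      using inj that part(1) by (metis inj_onD)
  qed
  have part_mult: "part (\<phi> f \<otimes> y) = f \<otimes> part y" if "f \<in> carrier G" "y \<in> carrier G" for f y
    using that part rep_closed by (intro part_eq) (auto simp: rep_mult m_assoc)
  define \<Omega> where "\<Omega> = carrier G \<times> {s. \<forall>n :: nat. s n \<in> rep ` carrier G}"
  \<comment> \<open>The functions are restricted to \<open>\<Omega>\<close> because elements of
    \<open>BijGroup \<Omega>\<close> are extensional.\<close>
  define act where "act f = (\<lambda>\<omega>\<in>\<Omega>. (f \<otimes> fst \<omega>, snd \<omega>))" for f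
  \<comment> \<open>\<open>T\<close> splits the first coordinate into its \<phi>-part and its
    representative, and pushes the representative onto the sequence.\<close>
  define T where "T = (\<lambda>\<omega>\<in>\<Omega>. (part (fst \<omega>), case_nat (rep (fst \<omega>)) (snd \<omega>)))"
  have act_Bij: "act f \<in> Bij \<Omega>" if f: "f \<in> carrier G" for f
  proof -
    have "bij_betw (\<lambda>\<omega>. (f \<otimes> fst \<omega>, snd \<omega>)) \<Omega> \<Omega>"
      by (rule bij_betw_byWitness[of _ "\<lambda>\<omega>. (inv f \<otimes> fst \<omega>, snd \<omega>)"])
        (use f in \<open>auto simp: \<Omega>_def m_assoc[symmetric]\<close>)
    then show ?thesis
      by (simp add: Bij_def act_def cong: bij_betw_cong)
  qed
  have T_Bij: "T \<in> Bij \<Omega>"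
  proof -
    have "bij_betw (\<lambda>\<omega>. (part (fst \<omega>), case_nat (rep (fst \<omega>)) (snd \<omega>))) \<Omega> \<Omega>"
    \<comment> \<open>The inverse pops the head of the sequence and multiplies it back.\<close>
    proof (rule bij_betw_byWitness[of _ "\<lambda>\<omega>. (\<phi> (fst \<omega>) \<otimes> snd \<omega> 0, \<lambda>n. snd \<omega> (Suc n))"])
      show "\<forall>\<omega>\<in>\<Omega>. (\<lambda>\<omega>. (\<phi> (fst \<omega>) \<otimes> snd \<omega> 0, \<lambda>n. snd \<omega> (Suc n)))
          (part (fst \<omega>), case_nat (rep (fst \<omega>)) (snd \<omega>)) = \<omega>"
        by (auto simp: \<Omega>_def part)
      show "\<forall>\<omega>\<in>\<Omega>. (\<lambda>\<omega>. (part (fst \<omega>), case_nat (rep (fst \<omega>)) (snd \<omega>)))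
          (\<phi> (fst \<omega>) \<otimes> snd \<omega> 0, \<lambda>n. snd \<omega> (Suc n)) = \<omega>"
      proof
        fix \<omega> assume "\<omega> \<in> \<Omega>"
        then obtain f s where \<omega>: "\<omega> = (f, s)" "f \<in> carrier G" "\<And>n. s n \<in> rep ` carrier G"
          by (auto simp: \<Omega>_def)
        then obtain y where y: "y \<in> carrier G" "s 0 = rep y" by blast
        have "rep (\<phi> f \<otimes> s 0) = s 0"
          using y \<omega> rep_closed by (simp add: rep_mult rep_rep)
        moreover have "part (\<phi> f \<otimes> s 0) = f"
          using calculation \<omega> y rep_closed by (intro part_eq) auto
        moreover have "case_nat (s 0) (\<lambda>n. s (Suc n)) = s"
          by (auto split: nat.split)
        ultimately show "(\<lambda>\<omega>. (part (fst \<omega>), case_nat (rep (fst \<omega>)) (snd \<omega>)))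
          (\<phi> (fst \<omega>) \<otimes> snd \<omega> 0, \<lambda>n. snd \<omega> (Suc n)) = \<omega>"
          by (simp add: \<omega>(1))
      qed
      have "s 0 \<in> carrier G" if "\<forall>n. s n \<in> rep ` carrier G" for s :: "nat \<Rightarrow> 'a"
        using that rep_closed by (metis imageE)
      then show "(\<lambda>\<omega>. (\<phi> (fst \<omega>) \<otimes> snd \<omega> 0, \<lambda>n. snd \<omega> (Suc n))) ` \<Omega> \<subseteq> \<Omega>"
        by (auto simp: \<Omega>_def)
    qed (use part in \<open>auto simp: \<Omega>_def split: nat.split\<close>)
    then show ?thesis
      by (simp add: Bij_def T_def cong: bij_betw_cong)
  qed
  then show "T \<in> carrier (BijGroup \<Omega>)"
    by (simp add: BijGroup_def)
  have act_in: "act f \<omega> \<in> \<Omega>" if "f \<in> carrier G" "\<omega> \<in> \<Omega>" for f \<omega>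
    using that by (auto simp: act_def \<Omega>_def)
  show "act \<in> hom G (BijGroup \<Omega>)"
  proof (rule homI)
    show "act (f \<otimes> g) = act f \<otimes>\<^bsub>BijGroup \<Omega>\<^esub> act g" if "f \<in> carrier G" "g \<in> carrier G" for f g
      using that act_Bij act_in[OF that(2)]
      by (auto simp: BijGroup_def compose_def fun_eq_iff act_def \<Omega>_def m_assoc restrict_def)
  qed (simp add: BijGroup_def act_Bij)
  show "inj_on act (carrier G)"
  proof (rule inj_onI)
    fix f g assume fg: "f \<in> carrier G" "g \<in> carrier G" "act f = act g"
    \<comment> \<open>At a point with first coordinate \<open>\<one>\<close>, the action of
      \<open>f\<close> shows \<open>f\<close> itself.\<close>
    have "(\<one>, \<lambda>_. rep \<one>) \<in> \<Omega>"
      by (auto simp: \<Omega>_def)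
    then show "f = g"
      using fun_cong[OF fg(3), of "(\<one>, \<lambda>_. rep \<one>)"] fg(1,2) by (simp add: act_def)
  qed
  show "act f \<otimes>\<^bsub>BijGroup \<Omega>\<^esub> T = T \<otimes>\<^bsub>BijGroup \<Omega>\<^esub> act (\<phi> f)" if f: "f \<in> carrier G" for f
  proof -
    have "T \<omega> \<in> \<Omega>" if "\<omega> \<in> \<Omega>" for \<omega>
      using T_Bij that by (auto dest: Bij_imp_funcset)
    moreover have "act (\<phi> f) \<in> Bij \<Omega>" "act f \<in> Bij \<Omega>"
      using act_Bij f by auto
    \<comment> \<open>Multiplying y by \<phi>(f) on the left keeps its representative and multiplies
      its part by \<open>f\<close>.\<close>
    moreover have "act f (T \<omega>) = T (act (\<phi> f) \<omega>)" if "\<omega> \<in> \<Omega>" for \<omega>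
      using that f calculation(1)[OF that] act_in[OF _ that, of "\<phi> f"]
      by (auto simp: act_def T_def \<Omega>_def part_mult rep_mult)
    ultimately show ?thesis
      using T_Bij by (auto simp: BijGroup_def compose_def fun_eq_iff restrict_def)
  qed
qed

section \<open>Local orders on ascending extensions\<close>

text \<open>The cone of \<open>F\<close> is not assumed to be compatible with \<open>\<phi>\<close>,
  so its transports to different conjugates of \<open>F\<close> need not agree. A finite set
  \<open>D\<close> meets the kernel of \<open>deg\<close> inside a single conjugate, where one
  transport is enough.\<close>

lemma locally_left_orderable_ascending:
  fixes G (structure) and F (structure)
  assumes G: "group G" and F: "group F" and ord: "left_orderable F"
    and base: "base \<in> hom F G" and inj: "inj_on base (carrier F)"
    and t: "t \<in> carrier G" and \<phi>: "\<phi> \<in> carrier F \<rightarrow> carrier F"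
    and conj: "\<And>f. f \<in> carrier F \<Longrightarrow> base f \<otimes>\<^bsub>G\<^esub> t = t \<otimes>\<^bsub>G\<^esub> base (\<phi> f)"
    and deg: "deg \<in> hom G integer_group" "deg t = 1" "\<And>f. f \<in> carrier F \<Longrightarrow> deg (base f) = 0"
    and gen: "\<And>g. g \<in> carrier G \<Longrightarrow> \<exists>(a :: nat) (b :: nat) f. f \<in> carrier F \<and>
      g = t [^]\<^bsub>G\<^esub> a \<otimes>\<^bsub>G\<^esub> base f \<otimes>\<^bsub>G\<^esub> inv\<^bsub>G\<^esub> (t [^]\<^bsub>G\<^esub> b)"
  shows "locally_left_orderable G"
  unfolding locally_left_orderable_def
proof (intro allI impI)
  interpret G: group G by fact
  interpret F: group F by fact
  interpret base: group_hom F G base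
    using base by unfold_locales
  interpret deg: group_hom G integer_group deg
    using deg by (simp add: group_hom_def group_hom_axioms_def G)
  \<comment> \<open>\<open>cj n\<close> embeds \<open>F\<close> with image
    \<open>t^n F t^-n\<close>.\<close>
  define cj where "cj n f = t [^]\<^bsub>G\<^esub> n \<otimes>\<^bsub>G\<^esub> base f \<otimes>\<^bsub>G\<^esub> inv\<^bsub>G\<^esub> (t [^]\<^bsub>G\<^esub> n)" for n :: nat and f
  have cj_closed: "cj n f \<in> carrier G" if "f \<in> carrier F" for n f
    using that t by (simp add: cj_def)
  have cj_mult: "cj n (f \<otimes>\<^bsub>F\<^esub> g) = cj n f \<otimes>\<^bsub>G\<^esub> cj n g" if "f \<in> carrier F" "g \<in> carrier F" for n f g
  proof -
    have "inv\<^bsub>G\<^esub> (t [^]\<^bsub>G\<^esub> n) \<otimes>\<^bsub>G\<^esub> (t [^]\<^bsub>G\<^esub> n \<otimes>\<^bsub>G\<^esub> x) = x" if "x \<in> carrier G" for x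
      using that t by (simp add: G.m_assoc[symmetric])
    then show ?thesis
      using that t by (simp add: cj_def G.m_assoc)
  qed
  have cj_hom: "group_hom F G (cj n)" for n
    by unfold_locales (auto intro!: homI simp: cj_closed cj_mult)
  have cj_one: "f = \<one>\<^bsub>F\<^esub>" if "f \<in> carrier F" "cj n f = \<one>\<^bsub>G\<^esub>" for n f
  proof -
    have "t [^]\<^bsub>G\<^esub> n \<otimes>\<^bsub>G\<^esub> base f = t [^]\<^bsub>G\<^esub> n"
      using that t unfolding cj_def
      by (metis G.inv_closed G.inv_equality G.inv_inv G.m_closed G.nat_pow_closed base.hom_closed)
    then have "base f = \<one>\<^bsub>G\<^esub>"
      using that t by simp
    then show ?thesis
      using that inj by (metis F.one_closed base.hom_one inj_onD)
  qed
  have deg_cj: "deg (cj n f) = 0" if "f \<in> carrier F" for n f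
    using that t deg by (simp add: cj_def)
  \<comment> \<open>By \<open>conj\<close>, \<open>base f\<close> is the conjugate t \<phi>(f) t^-1,
    so each conjugate of \<open>F\<close> lies in the next one.\<close>
  have cj_Suc: "cj n f = cj (Suc n) (\<phi> f)" if f: "f \<in> carrier F" for n f
  proof -
    have \<phi>f: "\<phi> f \<in> carrier F"
      using f \<phi> by auto
    have "cj (Suc n) (\<phi> f) =
        t [^]\<^bsub>G\<^esub> n \<otimes>\<^bsub>G\<^esub> (t \<otimes>\<^bsub>G\<^esub> base (\<phi> f)) \<otimes>\<^bsub>G\<^esub> inv\<^bsub>G\<^esub> t \<otimes>\<^bsub>G\<^esub> inv\<^bsub>G\<^esub> (t [^]\<^bsub>G\<^esub> n)"
      using t \<phi>f by (simp add: cj_def G.inv_mult_group G.m_assoc)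
    also have "\<dots> = t [^]\<^bsub>G\<^esub> n \<otimes>\<^bsub>G\<^esub> base f \<otimes>\<^bsub>G\<^esub> (t \<otimes>\<^bsub>G\<^esub> inv\<^bsub>G\<^esub> t) \<otimes>\<^bsub>G\<^esub> inv\<^bsub>G\<^esub> (t [^]\<^bsub>G\<^esub> n)"
      using t f by (simp only: conj[OF f, symmetric]) (simp add: G.m_assoc del: G.r_inv)
    also have "\<dots> = cj n f"
      using t f by (simp add: cj_def)
    finally show ?thesis by simp
  qed
  have cj_mono: "\<exists>f'\<in>carrier F. cj m f = cj (m + k) f'" if "f \<in> carrier F" for m k f
  proof (induction k)
    case 0
    then show ?case using that by auto
  next
    case (Suc k)
    then obtain f' where "f' \<in> carrier F" "cj m f = cj (m + k) f'" by blast
    then show ?case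
      using cj_Suc[of f' "m + k"] \<phi> by (intro bexI[of _ "\<phi> f'"]) auto
  qed
  fix D assume D: "finite D \<and> D \<subseteq> carrier G"
  have "\<exists>n. \<forall>x\<in>D. deg x = 0 \<longrightarrow> x \<in> cj n ` carrier F"
  proof -
    have "\<exists>n. x \<in> cj n ` carrier F" if x: "x \<in> D" "deg x = 0" for x
    proof -
      obtain a b :: nat and f where f: "f \<in> carrier F"
        "x = t [^]\<^bsub>G\<^esub> a \<otimes>\<^bsub>G\<^esub> base f \<otimes>\<^bsub>G\<^esub> inv\<^bsub>G\<^esub> (t [^]\<^bsub>G\<^esub> b)"
        using gen x D by blast
      \<comment> \<open>Degree 0 forces a = b, which makes \<open>x\<close> a value of
        \<open>cj a\<close>.\<close>
      then have "deg x = int a - int b"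
        using t deg by (simp add: deg.hom_nat_pow)
      then show ?thesis
        using f x by (auto simp: cj_def)
    qed
    then obtain N where N: "\<And>x. x \<in> D \<Longrightarrow> deg x = 0 \<Longrightarrow> x \<in> cj (N x) ` carrier F"
      by metis
    \<comment> \<open>The sum serves as a common upper bound for the levels
      \<open>N x\<close>.\<close>
    have "x \<in> cj (sum N D) ` carrier F" if x: "x \<in> D" "deg x = 0" for x
    proof -
      have "N x \<le> sum N D"
        using D x by (intro member_le_sum) auto
      then obtain k where k: "sum N D = N x + k"
        using le_Suc_ex by blast
      obtain f where f: "f \<in> carrier F" "x = cj (N x) f"
        using N[OF x] by blast
      then show ?thesis
        using cj_mono[OF f(1), of "N x" k] k by auto
    qed
    then show ?thesis by blast
  qed
  then obtain n where n: "\<And>x. x \<in> D \<Longrightarrow> deg x = 0 \<Longrightarrow> x \<in> cj n ` carrier F"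
    by blast
  interpret cj: group_hom F G "cj n"
    by (rule cj_hom)
  obtain P where P: "positive_cone F (carrier F) P"
    using ord by (auto simp: left_orderable_def)
  \<comment> \<open>A lexicographic order: the degree decides first, then the cone of
    \<open>F\<close> at level \<open>n\<close>.\<close>
  define Q where "Q = {g \<in> carrier G. deg g > 0} \<union> cj n ` P"
  have PF: "P \<subseteq> carrier F"
    using P by (simp add: positive_cone_def)
  have "positive_cone G D Q"
    unfolding positive_cone_def
  proof (intro conjI ballI)
    show Q: "Q \<subseteq> carrier G"
      using PF cj_closed by (auto simp: Q_def)
    show "x \<otimes>\<^bsub>G\<^esub> y \<in> Q" if xy: "x \<in> Q" "y \<in> Q" for x y
    proof (cases "x \<in> cj n ` P \<and> y \<in> cj n ` P")
      case True
      then obtain p q where pq: "p \<in> P" "q \<in> P" "x = cj n p" "y = cj n q" by blast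
      then have "p \<in> carrier F" "q \<in> carrier F"
        using PF by auto
      then have "x \<otimes>\<^bsub>G\<^esub> y = cj n (p \<otimes>\<^bsub>F\<^esub> q)"
        using pq by (simp only: cj_mult)
      moreover have "p \<otimes>\<^bsub>F\<^esub> q \<in> P"
        using P pq(1,2) by (simp add: positive_cone_def)
      ultimately show ?thesis
        by (simp add: Q_def)
    next
      case False
      \<comment> \<open>Degrees on \<open>Q\<close> are nonnegative, and positive outside the image
        of \<open>P\<close>.\<close>
      then have "deg x + deg y > 0"
        using xy PF deg_cj by (auto simp: Q_def subset_iff)
      then show ?thesis
        using xy Q by (auto simp: Q_def subset_iff)
    qed
    show "\<one>\<^bsub>G\<^esub> \<notin> Q"
    proof
      assume "\<one>\<^bsub>G\<^esub> \<in> Q"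
      then obtain p where "p \<in> P" "cj n p = \<one>\<^bsub>G\<^esub>"
        using deg.hom_one by (auto simp: Q_def)
      then show False
        using cj_one P PF by (auto simp: positive_cone_def)
    qed
    show "x = \<one>\<^bsub>G\<^esub> \<or> x \<in> Q \<or> inv\<^bsub>G\<^esub> x \<in> Q" if x: "x \<in> D" for x
    proof (cases "deg x = 0")
      case True
      then obtain f where f: "f \<in> carrier F" "x = cj n f"
        using n x by blast
      then have "f = \<one>\<^bsub>F\<^esub> \<or> f \<in> P \<or> inv\<^bsub>F\<^esub> f \<in> P"
        using P by (simp add: positive_cone_def)
      moreover have "inv\<^bsub>G\<^esub> x = cj n (inv\<^bsub>F\<^esub> f)"
        using f by simp
      ultimately show ?thesis
        using f unfolding Q_def by (elim disjE) (simp_all del: cj.hom_inv)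
    next
      case False
      moreover have "deg (inv\<^bsub>G\<^esub> x) = - deg x" "x \<in> carrier G"
        using x D by auto
      ultimately show ?thesis
        by (auto simp: Q_def)
    qed
  qed
  then show "\<exists>P. positive_cone G D P" by blast
qed

section \<open>The presentation of an ascending HNN extension\<close>

definition hnn_gens :: "('a, 'b) monoid_scheme \<Rightarrow> 'a hnn_gen set"
  where "hnn_gens F = insert Stable (Base ` carrier F)"

definition hnn_rels :: "('a, 'b) monoid_scheme \<Rightarrow> ('a \<Rightarrow> 'a) \<Rightarrow> ('a hnn_gen word \<times> 'a hnn_gen word) set"
  where "hnn_rels F \<phi> =
    {([(Base f, True), (Base g, True)], [(Base (f \<otimes>\<^bsub>F\<^esub> g), True)]) |f g.
        f \<in> carrier F \<and> g \<in> carrier F} \<union>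
    {([(Stable, False), (Base f, True), (Stable, True)], [(Base (\<phi> f), True)]) |f.
        f \<in> carrier F}"

definition hnn_base :: "('a, 'b) monoid_scheme \<Rightarrow> ('a \<Rightarrow> 'a) \<Rightarrow> 'a \<Rightarrow> 'a hnn_gen word set"
  where "hnn_base F \<phi> f = pres_rel (hnn_gens F) (hnn_rels F \<phi>) `` {[(Base f, True)]}"

definition hnn_stable :: "('a, 'b) monoid_scheme \<Rightarrow> ('a \<Rightarrow> 'a) \<Rightarrow> 'a hnn_gen word set"
  where "hnn_stable F \<phi> = pres_rel (hnn_gens F) (hnn_rels F \<phi>) `` {[(Stable, True)]}"

lemma ascending_hnn_eq: "ascending_hnn F \<phi> = presented_group (hnn_gens F) (hnn_rels F \<phi>)"
  by (simp add: ascending_hnn_def hnn_gens_def hnn_rels_def)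

lemma hnn_gens_simps [simp]: "Stable \<in> hnn_gens F" "Base f \<in> hnn_gens F \<longleftrightarrow> f \<in> carrier F"
  by (auto simp: hnn_gens_def)

lemma group_ascending_hnn: "group (ascending_hnn F \<phi>)"
  by (simp add: ascending_hnn_eq group_presented_group)

lemma hnn_base_closed: "f \<in> carrier F \<Longrightarrow> hnn_base F \<phi> f \<in> carrier (ascending_hnn F \<phi>)"
  by (simp add: hnn_base_def ascending_hnn_eq presented_group_closed)

lemma hnn_stable_closed: "hnn_stable F \<phi> \<in> carrier (ascending_hnn F \<phi>)"
  by (simp add: hnn_stable_def ascending_hnn_eq presented_group_closed)

lemma hnn_base_hom:
  assumes "group F"
  shows "hnn_base F \<phi> \<in> hom F (ascending_hnn F \<phi>)"
proof (rule homI)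
  interpret F: group F by fact
  show "hnn_base F \<phi> (f \<otimes>\<^bsub>F\<^esub> g) = hnn_base F \<phi> f \<otimes>\<^bsub>ascending_hnn F \<phi>\<^esub> hnn_base F \<phi> g"
    if "f \<in> carrier F" "g \<in> carrier F" for f g
  proof -
    have "pres_cong (hnn_gens F) (hnn_rels F \<phi>) ([] @ [(Base f, True), (Base g, True)] @ [])
        ([] @ [(Base (f \<otimes>\<^bsub>F\<^esub> g), True)] @ [])"
      using that by (intro pres_relation) (auto simp: hnn_rels_def)
    then show ?thesis
      using that by (simp add: hnn_base_def ascending_hnn_eq presented_group_mult presented_group_eqI)
  qed
qed (rule hnn_base_closed)

text \<open>The relation t^-1 f t = \<phi>(f) multiplied by t on the left, a form free of
  inverses.\<close>

lemma hnn_conjugation: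
  assumes "\<phi> \<in> carrier F \<rightarrow> carrier F" "f \<in> carrier F"
  shows "hnn_base F \<phi> f \<otimes>\<^bsub>ascending_hnn F \<phi>\<^esub> hnn_stable F \<phi> =
    hnn_stable F \<phi> \<otimes>\<^bsub>ascending_hnn F \<phi>\<^esub> hnn_base F \<phi> (\<phi> f)"
proof -
  let ?S = "hnn_gens F" and ?R = "hnn_rels F \<phi>"
  let ?w = "[(Base f, True), (Stable, True)]"
  have \<phi>f: "\<phi> f \<in> carrier F"
    using assms by auto
  \<comment> \<open>The word t t^-1 f t is rewritten in two ways: by the relation here, by
    cancellation below.\<close>
  have "pres_cong ?S ?R ([(Stable, True)] @ [(Stable, False), (Base f, True), (Stable, True)] @ [])
      ([(Stable, True)] @ [(Base (\<phi> f), True)] @ [])"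
    using assms(2) \<phi>f by (intro pres_relation) (auto simp: hnn_rels_def)
  moreover have "pres_cong ?S ?R ([] @ [(Stable, True), (Stable, \<not> True)] @ ?w) ([] @ ?w)"
    using assms(2) by (intro pres_cancel) auto
  ultimately have "pres_cong ?S ?R ?w [(Stable, True), (Base (\<phi> f), True)]"
    using pres_trans pres_sym by fastforce
  then show ?thesis
    using assms(2) \<phi>f
    by (simp add: hnn_base_def hnn_stable_def ascending_hnn_eq presented_group_mult presented_group_eqI)
qed

text \<open>The universal property of the extension. It serves both the degree map and the embedding
  of \<open>F\<close>.\<close>

lemma ascending_hnn_hom:
  assumes "group H" and \<beta>: "\<beta> \<in> hom F H" and T: "T \<in> carrier H" and F: "group F"
    and \<phi>: "\<phi> \<in> carrier F \<rightarrow> carrier F"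
    and conj: "\<And>f. f \<in> carrier F \<Longrightarrow> \<beta> f \<otimes>\<^bsub>H\<^esub> T = T \<otimes>\<^bsub>H\<^esub> \<beta> (\<phi> f)"
  obtains e where "e \<in> hom (ascending_hnn F \<phi>) H" and "e (hnn_stable F \<phi>) = T"
    and "\<And>f. f \<in> carrier F \<Longrightarrow> e (hnn_base F \<phi> f) = \<beta> f"
proof -
  interpret H: group H by fact
  interpret \<beta>: group_hom F H \<beta>
    using assms by (simp add: group_hom_def group_hom_axioms_def)
  define h where "h = case_hnn_gen \<beta> T"
  have h: "h \<in> hnn_gens F \<rightarrow> carrier H"
    using T by (auto simp: h_def hnn_gens_def)
  have R: "word_val H h l = word_val H h r" if lr: "(l, r) \<in> hnn_rels F \<phi>" for l r
  proof -
    have "inv\<^bsub>H\<^esub> T \<otimes>\<^bsub>H\<^esub> (\<beta> f \<otimes>\<^bsub>H\<^esub> T) = \<beta> (\<phi> f)" if "f \<in> carrier F" for f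
      using that T \<phi> conj[OF that] by (auto simp: H.m_assoc[symmetric] Pi_iff)
    then show ?thesis
      using lr T \<phi> by (auto simp: hnn_rels_def h_def Pi_iff)
  qed
  obtain e where e: "e \<in> hom (ascending_hnn F \<phi>) H"
    "\<And>w. w \<in> words (hnn_gens F) \<Longrightarrow> e (pres_rel (hnn_gens F) (hnn_rels F \<phi>) `` {w}) = word_val H h w"
    using presented_group_hom[OF \<open>group H\<close> h R] unfolding ascending_hnn_eq by metis
  show ?thesis
  proof (rule that[OF e(1)])
    show "e (hnn_stable F \<phi>) = T"
      using T by (simp add: hnn_stable_def e(2)) (simp add: h_def)
    show "e (hnn_base F \<phi> f) = \<beta> f" if "f \<in> carrier F" for f
      using that by (simp add: hnn_base_def e(2)) (simp add: h_def)
  qed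
qed

text \<open>The extension maps to the bijections of \<open>\<Omega>\<close> so that
  \<open>hnn_base F \<phi> f\<close> goes to \<open>act f\<close>, and \<open>act\<close> is
  injective.\<close>

lemma hnn_base_inj:
  fixes F :: "('a, 'b) monoid_scheme"
  assumes F: "group F" and hom: "\<phi> \<in> hom F F" and inj: "inj_on \<phi> (carrier F)"
  shows "inj_on (hnn_base F \<phi>) (carrier F)"
proof -
  obtain \<Omega> :: "('a \<times> (nat \<Rightarrow> 'a)) set" and act T where act: "act \<in> hom F (BijGroup \<Omega>)" "inj_on act (carrier F)"
      "T \<in> carrier (BijGroup \<Omega>)"
    "\<And>f. f \<in> carrier F \<Longrightarrow> act f \<otimes>\<^bsub>BijGroup \<Omega>\<^esub> T = T \<otimes>\<^bsub>BijGroup \<Omega>\<^esub> act (\<phi> f)"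
    by (rule group.injective_endomorphism_conjugation[OF F hom inj]) blast
  obtain e where "\<And>f. f \<in> carrier F \<Longrightarrow> e (hnn_base F \<phi> f) = act f"
    using ascending_hnn_hom[OF group_BijGroup act(1,3) F _ act(4)] hom_carrier hom
    by (metis hom_carrier image_subset_iff_funcset)
  then show ?thesis
    using act(2) by (metis inj_on_def)
qed

text \<open>The elements of the required form include the identity and are preserved by left
  multiplication with generators and their inverses, so induction along a word reaches the whole
  group.\<close>

lemma ascending_hnn_normal_form:
  assumes F: "group F" and \<phi>: "\<phi> \<in> carrier F \<rightarrow> carrier F" and g: "g \<in> carrier (ascending_hnn F \<phi>)"
  shows "\<exists>(a :: nat) (b :: nat) f. f \<in> carrier F \<and> g = hnn_stable F \<phi> [^]\<^bsub>ascending_hnn F \<phi>\<^esub> a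
    \<otimes>\<^bsub>ascending_hnn F \<phi>\<^esub> hnn_base F \<phi> f \<otimes>\<^bsub>ascending_hnn F \<phi>\<^esub>
    inv\<^bsub>ascending_hnn F \<phi>\<^esub> (hnn_stable F \<phi> [^]\<^bsub>ascending_hnn F \<phi>\<^esub> b)"
proof -
  define G where "G = ascending_hnn F \<phi>"
  define t where "t = hnn_stable F \<phi>"
  define \<beta> where "\<beta> = hnn_base F \<phi>"
  interpret F: group F by fact
  interpret G: group G
    unfolding G_def by (rule group_ascending_hnn)
  interpret \<beta>: group_hom F G \<beta>
    using hnn_base_hom[OF F] by unfold_locales (simp add: G_def \<beta>_def)
  have t: "t \<in> carrier G"
    by (simp add: t_def G_def hnn_stable_closed)
  have conj: "\<beta> f \<otimes>\<^bsub>G\<^esub> t = t \<otimes>\<^bsub>G\<^esub> \<beta> (\<phi> f)" if "f \<in> carrier F" for f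
    using hnn_conjugation[OF \<phi> that] by (simp add: \<beta>_def t_def G_def)
  have \<phi>_closed: "\<phi> f \<in> carrier F" if "f \<in> carrier F" for f
    using \<phi> that by auto
  define N where "N = {t [^]\<^bsub>G\<^esub> a \<otimes>\<^bsub>G\<^esub> \<beta> f \<otimes>\<^bsub>G\<^esub> inv\<^bsub>G\<^esub> (t [^]\<^bsub>G\<^esub> b) |(a :: nat) (b :: nat) f. f \<in> carrier F}"
  have N_I: "t [^]\<^bsub>G\<^esub> a \<otimes>\<^bsub>G\<^esub> \<beta> f \<otimes>\<^bsub>G\<^esub> inv\<^bsub>G\<^esub> (t [^]\<^bsub>G\<^esub> b) \<in> N"
    if "f \<in> carrier F" for f and a b :: nat
    using that by (auto simp: N_def)
  have base: "\<beta> h \<otimes>\<^bsub>G\<^esub> x \<in> N" if h: "h \<in> carrier F" and x: "x \<in> N" for h x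
  proof -
    \<comment> \<open>Moving an element of \<open>F\<close> to the right past one \<open>t\<close>
      applies \<open>\<phi>\<close> once, so \<open>h'\<close> arises by \<open>a\<close>
      applications.\<close>
    have *: "\<exists>h'\<in>carrier F. \<beta> h \<otimes>\<^bsub>G\<^esub> t [^]\<^bsub>G\<^esub> a = t [^]\<^bsub>G\<^esub> a \<otimes>\<^bsub>G\<^esub> \<beta> h'" for a :: nat
    proof (induction a)
      case 0
      then show ?case using h by auto
    next
      case (Suc a)
      then obtain h' where h': "h' \<in> carrier F" "\<beta> h \<otimes>\<^bsub>G\<^esub> t [^]\<^bsub>G\<^esub> a = t [^]\<^bsub>G\<^esub> a \<otimes>\<^bsub>G\<^esub> \<beta> h'" by blast
      have "\<beta> h \<otimes>\<^bsub>G\<^esub> t [^]\<^bsub>G\<^esub> Suc a = t [^]\<^bsub>G\<^esub> a \<otimes>\<^bsub>G\<^esub> \<beta> h' \<otimes>\<^bsub>G\<^esub> t"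
        using h h' t by (simp add: G.m_assoc[symmetric])
      also have "\<dots> = t [^]\<^bsub>G\<^esub> Suc a \<otimes>\<^bsub>G\<^esub> \<beta> (\<phi> h')"
        using h' t \<phi>_closed by (simp add: G.m_assoc conj)
      finally show ?case
        using h' \<phi>_closed by blast
    qed
    obtain a b :: nat and f where f: "f \<in> carrier F" "x = t [^]\<^bsub>G\<^esub> a \<otimes>\<^bsub>G\<^esub> \<beta> f \<otimes>\<^bsub>G\<^esub> inv\<^bsub>G\<^esub> (t [^]\<^bsub>G\<^esub> b)"
      using x by (auto simp: N_def)
    obtain h' where h': "h' \<in> carrier F" "\<beta> h \<otimes>\<^bsub>G\<^esub> t [^]\<^bsub>G\<^esub> a = t [^]\<^bsub>G\<^esub> a \<otimes>\<^bsub>G\<^esub> \<beta> h'"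
      using * by blast
    have "\<beta> h \<otimes>\<^bsub>G\<^esub> x = \<beta> h \<otimes>\<^bsub>G\<^esub> t [^]\<^bsub>G\<^esub> a \<otimes>\<^bsub>G\<^esub> (\<beta> f \<otimes>\<^bsub>G\<^esub> inv\<^bsub>G\<^esub> (t [^]\<^bsub>G\<^esub> b))"
      using f h t by (simp add: G.m_assoc)
    also have "\<dots> = t [^]\<^bsub>G\<^esub> a \<otimes>\<^bsub>G\<^esub> \<beta> (h' \<otimes>\<^bsub>F\<^esub> f) \<otimes>\<^bsub>G\<^esub> inv\<^bsub>G\<^esub> (t [^]\<^bsub>G\<^esub> b)"
      unfolding h'(2) using f h' t by (simp add: G.m_assoc)
    finally show ?thesis
      using N_I[of "h' \<otimes>\<^bsub>F\<^esub> f" a b] f h' by simp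
  qed
  have stable: "t \<otimes>\<^bsub>G\<^esub> x \<in> N" if x: "x \<in> N" for x
  proof -
    obtain a b :: nat and f where f: "f \<in> carrier F" "x = t [^]\<^bsub>G\<^esub> a \<otimes>\<^bsub>G\<^esub> \<beta> f \<otimes>\<^bsub>G\<^esub> inv\<^bsub>G\<^esub> (t [^]\<^bsub>G\<^esub> b)"
      using x by (auto simp: N_def)
    have "t \<otimes>\<^bsub>G\<^esub> x = t [^]\<^bsub>G\<^esub> Suc a \<otimes>\<^bsub>G\<^esub> \<beta> f \<otimes>\<^bsub>G\<^esub> inv\<^bsub>G\<^esub> (t [^]\<^bsub>G\<^esub> b)"
      unfolding f(2) G.nat_pow_Suc2[OF t] using f t by (simp add: G.m_assoc)
    then show ?thesis
      using N_I[of f "Suc a" b] f by simp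
  qed
  have inv_stable: "inv\<^bsub>G\<^esub> t \<otimes>\<^bsub>G\<^esub> x \<in> N" if x: "x \<in> N" for x
  proof -
    obtain a b :: nat and f where f: "f \<in> carrier F" "x = t [^]\<^bsub>G\<^esub> a \<otimes>\<^bsub>G\<^esub> \<beta> f \<otimes>\<^bsub>G\<^esub> inv\<^bsub>G\<^esub> (t [^]\<^bsub>G\<^esub> b)"
      using x by (auto simp: N_def)
    show ?thesis
    proof (cases a)
      case 0
      \<comment> \<open>With no \<open>t\<close> on the left to cancel, t^-1 is moved past
        \<open>f\<close> and raises the exponent \<open>b\<close> by one.\<close>
      have "inv\<^bsub>G\<^esub> t \<otimes>\<^bsub>G\<^esub> \<beta> f = \<beta> (\<phi> f) \<otimes>\<^bsub>G\<^esub> inv\<^bsub>G\<^esub> t"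
      proof -
        have "inv\<^bsub>G\<^esub> t \<otimes>\<^bsub>G\<^esub> (\<beta> f \<otimes>\<^bsub>G\<^esub> t) \<otimes>\<^bsub>G\<^esub> inv\<^bsub>G\<^esub> t = inv\<^bsub>G\<^esub> t \<otimes>\<^bsub>G\<^esub> (t \<otimes>\<^bsub>G\<^esub> \<beta> (\<phi> f)) \<otimes>\<^bsub>G\<^esub> inv\<^bsub>G\<^esub> t"
          using conj[OF f(1)] by simp
        moreover have "inv\<^bsub>G\<^esub> t \<otimes>\<^bsub>G\<^esub> (t \<otimes>\<^bsub>G\<^esub> \<beta> (\<phi> f)) = \<beta> (\<phi> f)"
          using f(1) t \<phi>_closed by (simp add: G.m_assoc[symmetric])
        ultimately show ?thesis
          using f(1) t by (simp add: G.m_assoc)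
      qed
      then have "inv\<^bsub>G\<^esub> t \<otimes>\<^bsub>G\<^esub> x = \<beta> (\<phi> f) \<otimes>\<^bsub>G\<^esub> inv\<^bsub>G\<^esub> t \<otimes>\<^bsub>G\<^esub> inv\<^bsub>G\<^esub> (t [^]\<^bsub>G\<^esub> b)"
        using f t 0 by (simp add: G.m_assoc[symmetric])
      also have "\<dots> = t [^]\<^bsub>G\<^esub> (0 :: nat) \<otimes>\<^bsub>G\<^esub> \<beta> (\<phi> f) \<otimes>\<^bsub>G\<^esub> inv\<^bsub>G\<^esub> (t [^]\<^bsub>G\<^esub> Suc b)"
        using f t \<phi>_closed by (simp add: G.m_assoc G.inv_mult_group)
      finally show ?thesis
        using N_I[of "\<phi> f" 0 "Suc b"] f \<phi>_closed by simp
    next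
      case (Suc a')
      have "inv\<^bsub>G\<^esub> t \<otimes>\<^bsub>G\<^esub> (t \<otimes>\<^bsub>G\<^esub> y) = y" if "y \<in> carrier G" for y
        using that t by (simp add: G.m_assoc[symmetric])
      then have "inv\<^bsub>G\<^esub> t \<otimes>\<^bsub>G\<^esub> x = t [^]\<^bsub>G\<^esub> a' \<otimes>\<^bsub>G\<^esub> \<beta> f \<otimes>\<^bsub>G\<^esub> inv\<^bsub>G\<^esub> (t [^]\<^bsub>G\<^esub> b)"
        unfolding f(2) Suc G.nat_pow_Suc2[OF t] using f t by (simp add: G.m_assoc)
      then show ?thesis
        using N_I[of f a' b] f by simp
    qed
  qed
  let ?c = "\<lambda>w. pres_rel (hnn_gens F) (hnn_rels F \<phi>) `` {w}"
  have "?c w \<in> N" if "w \<in> words (hnn_gens F)" for w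
    using that
  proof (induction w)
    case Nil
    have "?c [] = \<one>\<^bsub>G\<^esub>"
      by (simp add: G_def ascending_hnn_eq presented_group_def)
    then show ?case
      using N_I[of "\<one>\<^bsub>F\<^esub>" 0 0] by simp
  next
    case (Cons x w)
    obtain s b where x: "x = (s, b)" by force
    have s: "s \<in> hnn_gens F" and w: "w \<in> words (hnn_gens F)" "?c w \<in> N"
      using Cons x by auto
    have cons: "?c (x # w) = ?c [(s, b)] \<otimes>\<^bsub>G\<^esub> ?c w"
      using presented_group_mult[of "[(s, b)]" "hnn_gens F" w "hnn_rels F \<phi>"] s w
      by (simp add: x G_def ascending_hnn_eq)
    have inv: "?c [(s, False)] = inv\<^bsub>G\<^esub> (?c [(s, True)])"
      using presented_group_inv_letter[OF s] by (simp add: G_def ascending_hnn_eq)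
    show ?case
    proof (cases s)
      case (Base f)
      then have f: "f \<in> carrier F" and c: "?c [(s, True)] = \<beta> f"
        using s by (auto simp: \<beta>_def hnn_base_def)
      then have "?c [(s, b)] = \<beta> (if b then f else inv\<^bsub>F\<^esub> f)"
        using inv by (cases b) auto
      then show ?thesis
        unfolding cons using base[of "if b then f else inv\<^bsub>F\<^esub> f"] f w by simp
    next
      case Stable
      then have "?c [(s, True)] = t"
        by (simp add: t_def hnn_stable_def)
      then have "?c [(s, b)] = (if b then t else inv\<^bsub>G\<^esub> t)"
        using inv by (cases b) auto
      then show ?thesis
        unfolding cons using stable inv_stable w by simp
    qed
  qed
  moreover have "carrier G = ?c ` words (hnn_gens F)"
    by (auto simp: G_def ascending_hnn_eq presented_group_def quotient_def)
  ultimately have "g \<in> N"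
    using g by (auto simp: G_def)
  then show ?thesis
    by (auto simp: N_def G_def t_def \<beta>_def)
qed

section \<open>Semiprimitivity for ascending HNN extensions of free groups\<close>

theorem corollary4p7:
  fixes F :: "('a, 'b) monoid_scheme" and \<phi> :: "'a \<Rightarrow> 'a" and K :: "('k, 'm) ring_scheme"
  assumes "is_free_group F" and "\<not> comm_group F"
    and "\<phi> \<in> hom F F" and "inj_on \<phi> (carrier F)"
    and "field K"
  shows "semiprimitive (group_ring K (ascending_hnn F \<phi>))"
proof (rule semiprimitive_group_ring)
  let ?G = "ascending_hnn F \<phi>" and ?t = "hnn_stable F \<phi>"
  have F: "group F"
    using assms(1) by (simp add: is_free_group_def)
  interpret F: group F by fact
  show G: "group ?G"
    by (rule group_ascending_hnn)
  interpret G: group ?G by fact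
  have \<phi>: "\<phi> \<in> carrier F \<rightarrow> carrier F"
    using assms(3) by (simp add: hom_def)
  have zero: "(\<lambda>_. 0) \<in> hom F integer_group"
    by (simp add: hom_def)
  \<comment> \<open>The exponent of \<open>t\<close>: sending \<open>F\<close> to 0 and
    \<open>t\<close> to 1 respects the conjugation relation because the integers commute.\<close>
  obtain deg where deg: "deg \<in> hom ?G integer_group" "deg ?t = 1"
      "\<And>f. f \<in> carrier F \<Longrightarrow> deg (hnn_base F \<phi> f) = 0"
    by (rule ascending_hnn_hom[OF group_integer_group zero _ F \<phi>, of 1]) auto
  show "locally_left_orderable ?G"
    by (rule locally_left_orderable_ascending[OF G F left_orderable_is_free_group[OF assms(1)]
          hnn_base_hom[OF F] hnn_base_inj[OF F assms(3,4)] hnn_stable_closed \<phi> hnn_conjugation[OF \<phi>] deg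
          ascending_hnn_normal_form[OF F \<phi>]])
  \<comment> \<open>Distinct powers of \<open>t\<close> have distinct degrees, so the group is
    infinite.\<close>
  have "deg (?t [^]\<^bsub>?G\<^esub> n) = int n" for n :: nat
    using hom_nat_pow[OF deg(1) hnn_stable_closed G group_integer_group] deg(2) by simp
  then have "inj (\<lambda>n :: nat. ?t [^]\<^bsub>?G\<^esub> n)"
    by (metis injI of_nat_eq_iff)
  moreover have "range (\<lambda>n :: nat. ?t [^]\<^bsub>?G\<^esub> n) \<subseteq> carrier ?G"
    using hnn_stable_closed by auto
  ultimately show "infinite (carrier ?G)"
    using infinite_iff_countable_subset by blast
qed (rule assms(5))

end
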